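(* Let $u\colon \mathbb{C}\to\mathbb{R}$ be a solution of $\Delta u+e^{2u}=0$ in the plane, and let $f$ be a developing map of $u$, i.e. a meromorphic function $f$ in $\mathbb{C}$ that is a local homeomorphism into $\overline{\mathbb{C}}$ with $$u=\log\frac{2|f'|}{1+|f|^2}.$$ (i) If $u$ is quasiconcave, then either $f$ is linear-fractional, or $f(z)=L(e^{az+b})$ for some linear-fractional transformation $L$ and some $a,b\in\mathbb{C}$ with $a\neq0$. (ii) If $f$ is transcendental and not of the form $L(e^{az+b})$ with $L$ linear-fractional and $a,b\in\mathbb{C}$, $a\neq 0$, then for every $M>0$ there exist $a_1,a_2\in\mathbb{C}$ such that $$u\left(\frac{a_1+a_2}{2}\right)<\min\{u(a_1),u(a_2)\}-M.$$
   Context: $\overline{\mathbb{C}}=\mathbb{C}\cup\{\infty\}$ is the Riemann sphere. By Liouville, every solution $u$ of $\Delta u+e^{2u}=0$ in the plane has the form $u=\log\frac{2|f'|}{1+|f|^2}$ for some meromorphic local homeomorphism $f\colon\mathbb{C}\to\overline{\mathbb{C}}$, that is, a meromorphic function with only simple poles and with $f'(z)\neq0$ at all points that are not poles; at the poles of $f$ the expression is understood by continuous extension. Such an $f$ is called a developing map. A function $h\colon\mathbb{C}\to\mathbb{R}$ is called quasiconcave if, for any $a_1,a_2\in\mathbb{C}$, one has $h(z)\ge\min\{h(a_1),h(a_2)\}$ for all $z$ on the line segment from $a_1$ to $a_2$; equivalently, for every $c\in\mathbb{R}$ the set $\{z\colon h(z)\ge c\}$ is convex. A linear-fractional transformation is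 an (invertible) Möbius transformation. A meromorphic function in $\mathbb{C}$ is transcendental if it is not a rational function. *)

theory Defs
  imports "HOL-Complex_Analysis.Complex_Analysis"
begin

text \<open>
  The equation. The plane is the real vector space underlying \<^typ>\<open>complex\<close>, so the
  directions \<open>1\<close> and \<open>\<i>\<close> give the partial derivatives in \<open>x\<close> and \<open>y\<close>.
  Differentiability is required separately in \<open>C2_plane\<close>, because
  \<^const>\<open>frechet_derivative\<close> is total and unspecified where no derivative exists.
\<close>

definition partial_deriv :: "complex \<Rightarrow> (complex \<Rightarrow> real) \<Rightarrow> complex \<Rightarrow> real" where
  "partial_deriv v u z = frechet_derivative u (at z) v"

definition C1_plane :: "(complex \<Rightarrow> real) \<Rightarrow> bool" where
  "C1_plane u \<longleftrightarrow> u differentiable_on UNIV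
     \<and> continuous_on UNIV (partial_deriv 1 u) \<and> continuous_on UNIV (partial_deriv \<i> u)"

definition C2_plane :: "(complex \<Rightarrow> real) \<Rightarrow> bool" where
  "C2_plane u \<longleftrightarrow> C1_plane u \<and> C1_plane (partial_deriv 1 u) \<and> C1_plane (partial_deriv \<i> u)"

definition laplacian :: "(complex \<Rightarrow> real) \<Rightarrow> complex \<Rightarrow> real" where
  "laplacian u z = partial_deriv 1 (partial_deriv 1 u) z + partial_deriv \<i> (partial_deriv \<i> u) z"

definition liouville_solution :: "(complex \<Rightarrow> real) \<Rightarrow> bool" where
  "liouville_solution u \<longleftrightarrow> C2_plane u \<and> (\<forall>z. laplacian u z + exp (2 * u z) = 0)"

text \<open>
  A meromorphic function in the plane is rendered by \<^const>\<open>nicely_meromorphic_on\<close>: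
  there are no removable singularities, and the value \<open>0\<close> stored at a pole is only a
  placeholder for \<open>\<infinity>\<close>. The actual map into the Riemann sphere is \<open>sphere_map\<close> below.
\<close>

definition meromorphic_local_homeo :: "(complex \<Rightarrow> complex) \<Rightarrow> bool" where
  "meromorphic_local_homeo f \<longleftrightarrow> f nicely_meromorphic_on UNIV
     \<and> (\<forall>z. is_pole f z \<longrightarrow> zorder f z = -1)
     \<and> (\<forall>z. \<not> is_pole f z \<longrightarrow> deriv f z \<noteq> 0)"

text \<open>
  At a pole of \<open>f\<close> the value of \<open>u\<close> is the limit of the formula along nearby points, which
  are not poles since poles are isolated.
\<close>

definition developing_map :: "(complex \<Rightarrow> complex) \<Rightarrow> (complex \<Rightarrow> real) \<Rightarrow> bool" where
  "developing_map f u \<longleftrightarrow> meromorphic_local_homeo f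
     \<and> (\<forall>z. \<not> is_pole f z \<longrightarrow> u z = ln (2 * norm (deriv f z) / (1 + (norm (f z))\<^sup>2)))
     \<and> (\<forall>z. is_pole f z \<longrightarrow> (\<lambda>w. ln (2 * norm (deriv f w) / (1 + (norm (f w))\<^sup>2))) \<midarrow>z\<rightarrow> u z)"

definition quasiconcave :: "(complex \<Rightarrow> real) \<Rightarrow> bool" where
  "quasiconcave h \<longleftrightarrow> (\<forall>a\<^sub>1 a\<^sub>2. \<forall>z\<in>closed_segment a\<^sub>1 a\<^sub>2. h z \<ge> min (h a\<^sub>1) (h a\<^sub>2))"

datatype riemann_sphere = Finite complex | Infinity

definition sphere_map :: "(complex \<Rightarrow> complex) \<Rightarrow> complex \<Rightarrow> riemann_sphere" where
  "sphere_map f z = (if is_pole f z then Infinity else Finite (f z))"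

fun sphere_moebius ::
    "complex \<Rightarrow> complex \<Rightarrow> complex \<Rightarrow> complex \<Rightarrow> riemann_sphere \<Rightarrow> riemann_sphere" where
  "sphere_moebius a b c d (Finite z) =
     (if c * z + d = 0 then Infinity else Finite (moebius a b c d z))"
| "sphere_moebius a b c d Infinity = (if c = 0 then Infinity else Finite (a / c))"

definition linear_fractional :: "(riemann_sphere \<Rightarrow> riemann_sphere) \<Rightarrow> bool" where
  "linear_fractional L \<longleftrightarrow> (\<exists>a b c d. a * d - b * c \<noteq> 0 \<and> L = sphere_moebius a b c d)"

definition is_linear_fractional :: "(complex \<Rightarrow> complex) \<Rightarrow> bool" where
  "is_linear_fractional f \<longleftrightarrow> (\<exists>L. linear_fractional L \<and> (\<forall>z. sphere_map f z = L (Finite z)))"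

definition is_linear_fractional_of_exp :: "(complex \<Rightarrow> complex) \<Rightarrow> bool" where
  "is_linear_fractional_of_exp f \<longleftrightarrow>
     (\<exists>L a b. linear_fractional L \<and> a \<noteq> 0 \<and> (\<forall>z. sphere_map f z = L (Finite (exp (a * z + b)))))"

text \<open>
  The polynomials \<open>p\<close> and \<open>q\<close> need not be coprime. For meromorphic \<open>f\<close>, equality off the
  finitely many zeros of \<open>q\<close> already determines \<open>f\<close> as a map into the sphere.
\<close>

definition rational_function :: "(complex \<Rightarrow> complex) \<Rightarrow> bool" where
  "rational_function f \<longleftrightarrow>
     (\<exists>p q :: complex poly. q \<noteq> 0 \<and> (\<forall>z. poly q z \<noteq> 0 \<longrightarrow> f z = poly p z / poly q z))"

definition transcendental_meromorphic :: "(complex \<Rightarrow> complex) \<Rightarrow> bool" where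
  "transcendental_meromorphic f \<longleftrightarrow> f nicely_meromorphic_on UNIV \<and> \<not> rational_function f"

end

theory Submission
  imports Defs
begin

text \<open>
  A developing map is a quotient \<open>f = w1 / w2\<close> of solutions of \<open>w'' + P w = 0\<close> with \<open>P\<close> entire
  and Wronskian one, and then \<open>u = ln (2 / v)\<close> with \<open>v = |w1|\<^sup>2 + |w2|\<^sup>2\<close>. If \<open>P\<close> is
  constant, \<open>f\<close> is linear-fractional or a linear-fractional function of an exponential.

  If \<open>P\<close> is not constant, a maximum argument yields annular sectors, arbitrarily large in the metric
  \<open>|P|\<^sup>1\<^sup>/\<^sup>2 |dz|\<close>, on which \<open>P\<close> is close to a multiple of \<open>z\<^sup>N\<close>. In the coordinate \<open>Z\<close>
  with \<open>z = s Z\<^sup>\<kappa>\<close>, \<open>\<kappa> = 2 / (N + 2)\<close>, the equation becomes almost \<open>W'' + M\<^sup>2 W = 0\<close> with \<open>M\<close>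
  large. There the energy \<open>|W|\<^sup>2 + |W'|\<^sup>2 / M\<^sup>2\<close> hardly changes along horizontal lines, whereas on a vertical
  line \<open>v\<close> is convex and grows exponentially in at least one of the two directions away from the real
  axis. As \<open>\<kappa> < 1\<close>, straight chords in the \<open>z\<close>-plane can be chosen so that in the \<open>Z\<close>-plane their
  midpoint lies farther from the real axis than their end points; on such a chord \<open>v\<close> at the
  midpoint exceeds its values at the end points by an arbitrarily large factor.
\<close>

subsection \<open>Almost harmonic oscillators\<close>

lemma has_real_derivative_inner:
  fixes g h :: "real \<Rightarrow> 'a::real_inner"
  assumes "(g has_vector_derivative g') (at t)" "(h has_vector_derivative h') (at t)"
  shows "((\<lambda>t. g t \<bullet> h t) has_real_derivative (g t \<bullet> h' + g' \<bullet> h t)) (at t)"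
  using bounded_bilinear.has_vector_derivative[OF bounded_bilinear_inner assms]
  by (simp add: has_real_derivative_iff_has_vector_derivative)

lemma has_real_derivative_norm_power2:
  fixes g :: "real \<Rightarrow> 'a::real_inner"
  assumes "(g has_vector_derivative g') (at t)"
  shows "((\<lambda>t. (norm (g t))\<^sup>2) has_real_derivative 2 * (g t \<bullet> g')) (at t)"
  using has_real_derivative_inner[OF assms assms]
  by (simp add: power2_norm_eq_inner inner_commute)

text \<open>Gronwall's inequality: the weight \<open>exp (- k * (t - a))\<close> makes
  \<open>J\<close> nondecreasing. The sign of \<open>J\<close> is free, so for a negative function
  this becomes an upper growth bound.\<close>

lemma nondecreasing_exp_weight:
  fixes J :: "real \<Rightarrow> real"
  assumes "a \<le> b"
    and J: "\<And>t. a \<le> t \<Longrightarrow> t \<le> b \<Longrightarrow> (J has_real_derivative J' t) (at t)"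
    and ge: "\<And>t. a \<le> t \<Longrightarrow> t \<le> b \<Longrightarrow> J' t \<ge> k * J t"
  shows "J b \<ge> J a * exp (k * (b - a))"
proof -
  have "J a * exp (- k * (a - a)) \<le> J b * exp (- k * (b - a))"
  proof (rule DERIV_nonneg_imp_nondecreasing[OF \<open>a \<le> b\<close>])
    fix t assume t: "a \<le> t" "t \<le> b"
    have "((\<lambda>t. J t * exp (- k * (t - a))) has_real_derivative
        (J' t - k * J t) * exp (- k * (t - a))) (at t)"
      by (rule derivative_eq_intros J t refl)+ (simp add: algebra_simps)
    moreover have "(J' t - k * J t) * exp (- k * (t - a)) \<ge> 0"
      using ge[OF t] by simp
    ultimately show "\<exists>y. ((\<lambda>t. J t * exp (- k * (t - a))) has_real_derivative y) (at t) \<and> 0 \<le> y"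
      by blast
  qed
  then have "J a * exp (k * (b - a)) \<le> J b * exp (- k * (b - a)) * exp (k * (b - a))"
    by (intro mult_right_mono) simp_all
  also have "\<dots> = J b"
    by (simp flip: exp_add)
  finally show ?thesis .
qed

text \<open>The energy of an oscillator of frequency \<open>M\<close>, with \<open>x\<close> for a
  solution and \<open>y\<close> for its derivative, normalised so that it dominates
  \<open>(norm x)\<^sup>2\<close>.\<close>

definition energy :: "real \<Rightarrow> complex \<Rightarrow> complex \<Rightarrow> real" where
  "energy M x y = (norm x)\<^sup>2 + (norm y)\<^sup>2 / M\<^sup>2"

lemma energy_scaled: "M > 0 \<Longrightarrow> M\<^sup>2 * energy M x y = M\<^sup>2 * (norm x)\<^sup>2 + (norm y)\<^sup>2"
  by (simp add: energy_def distrib_left)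

lemma norm_add_mult_power2:
  "(norm (y + of_real M * x))\<^sup>2 = (norm y)\<^sup>2 + M\<^sup>2 * (norm x)\<^sup>2 + 2 * M * (x \<bullet> y)" for x y :: complex
  unfolding power2_norm_eq_inner scaleR_conv_of_real[symmetric]
  by (simp add: inner_add_left inner_add_right inner_commute power2_eq_square)

lemma has_real_derivative_energy:
  assumes "M > 0" "(g has_vector_derivative g') (at t)" "(h has_vector_derivative h') (at t)"
  shows "((\<lambda>t. energy M (g t) (h t)) has_real_derivative
    2 * (g t \<bullet> g') + 2 * (h t \<bullet> h') / M\<^sup>2) (at t)"
  unfolding energy_def
  by (intro DERIV_add DERIV_cdivide has_real_derivative_norm_power2 assms)

lemma two_norms_le_energy:
  assumes "M > 0"
  shows "2 * norm x * norm y \<le> M * energy M x y"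
proof -
  have "0 \<le> (M * norm x - norm y)\<^sup>2 / M"
    using assms by simp
  also have "\<dots> = M * energy M x y - 2 * norm x * norm y"
    using assms by (simp add: energy_def field_simps power2_eq_square)
  finally show ?thesis by simp
qed

text \<open>For \<open>\<phi> = 1\<close> and \<open>\<rho> = 0\<close> the energy is conserved.\<close>

lemma oscillatory_energy_le:
  fixes g g' :: "real \<Rightarrow> complex"
  assumes M: "M > 0" and L: "0 \<le> L"
    and g: "\<And>t. 0 \<le> t \<Longrightarrow> t \<le> L \<Longrightarrow> (g has_vector_derivative g' t) (at t)"
    and g': "\<And>t. 0 \<le> t \<Longrightarrow> t \<le> L \<Longrightarrow>
      (g' has_vector_derivative (\<rho> t * g' t - of_real (M\<^sup>2) * \<phi> t * g t)) (at t)"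
    and \<phi>: "\<And>t. 0 \<le> t \<Longrightarrow> t \<le> L \<Longrightarrow> norm (\<phi> t - 1) \<le> e"
    and \<rho>: "\<And>t. 0 \<le> t \<Longrightarrow> t \<le> L \<Longrightarrow> norm (\<rho> t) \<le> r"
  shows "energy M (g L) (g' L) \<le> energy M (g 0) (g' 0) * exp ((e * M + 2 * r) * L)"
proof -
  define E' where "E' t = 2 * (g t \<bullet> g' t)
    + 2 * (g' t \<bullet> (\<rho> t * g' t - of_real (M\<^sup>2) * \<phi> t * g t)) / M\<^sup>2" for t
  \<comment> \<open>\<open>nondecreasing_exp_weight\<close> bounds from below, so it is applied to
    the negative of the energy.\<close>
  have "- energy M (g L) (g' L) \<ge> - energy M (g 0) (g' 0) * exp ((e * M + 2 * r) * (L - 0))"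
  proof (rule nondecreasing_exp_weight[OF L])
    fix t assume t: "0 \<le> t" "t \<le> L"
    show "((\<lambda>t. - energy M (g t) (g' t)) has_real_derivative - E' t) (at t)"
      unfolding E'_def by (intro DERIV_minus has_real_derivative_energy M g g' t)
    \<comment> \<open>The unperturbed part of the second derivative cancels
      \<open>2 * (g t \<bullet> g' t)\<close>; only \<open>\<rho>\<close> and
      \<open>\<phi> - 1\<close> remain.\<close>
    have "E' t = 2 * (g' t \<bullet> (\<rho> t * g' t)) / M\<^sup>2 - 2 * (g' t \<bullet> ((\<phi> t - 1) * g t))"
    proof -
      have "\<rho> t * g' t - of_real (M\<^sup>2) * \<phi> t * g t
          = \<rho> t * g' t - M\<^sup>2 *\<^sub>R ((\<phi> t - 1) * g t) - M\<^sup>2 *\<^sub>R g t"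
        by (simp add: scaleR_conv_of_real algebra_simps)
      then have "g' t \<bullet> (\<rho> t * g' t - of_real (M\<^sup>2) * \<phi> t * g t)
          = g' t \<bullet> (\<rho> t * g' t) - M\<^sup>2 * (g' t \<bullet> ((\<phi> t - 1) * g t)) - M\<^sup>2 * (g t \<bullet> g' t)"
        by (simp only: inner_diff_right inner_scaleR_right inner_commute)
      then show ?thesis
        using M unfolding E'_def by (simp add: field_simps)
    qed
    also have "\<dots> \<le> 2 * (r * (norm (g' t))\<^sup>2) / M\<^sup>2 + e * (2 * norm (g t) * norm (g' t))"
    proof -
      have "g' t \<bullet> (\<rho> t * g' t) \<le> norm (g' t) * (norm (\<rho> t) * norm (g' t))"
        using norm_cauchy_schwarz[of "g' t" "\<rho> t * g' t"] by (simp add: norm_mult)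
      also have "\<dots> \<le> norm (g' t) * (r * norm (g' t))"
        using \<rho>[OF t] by (intro mult_left_mono mult_right_mono) auto
      finally have 1: "g' t \<bullet> (\<rho> t * g' t) \<le> r * (norm (g' t))\<^sup>2"
        by (simp add: power2_eq_square algebra_simps)
      have "\<bar>g' t \<bullet> ((\<phi> t - 1) * g t)\<bar> \<le> norm (g' t) * (norm (\<phi> t - 1) * norm (g t))"
        using Cauchy_Schwarz_ineq2[of "g' t" "(\<phi> t - 1) * g t"] by (simp add: norm_mult)
      also have "\<dots> \<le> norm (g' t) * (e * norm (g t))"
        using \<phi>[OF t] by (intro mult_left_mono mult_right_mono) auto
      finally have 2: "\<bar>g' t \<bullet> ((\<phi> t - 1) * g t)\<bar> \<le> e * (norm (g t) * norm (g' t))"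
        by (simp add: algebra_simps)
      have "2 * (g' t \<bullet> (\<rho> t * g' t)) / M\<^sup>2 \<le> 2 * (r * (norm (g' t))\<^sup>2) / M\<^sup>2"
        using 1 by (intro divide_right_mono) auto
      then show ?thesis
        using 2 by linarith
    qed
    also have "\<dots> \<le> 2 * r * energy M (g t) (g' t) + e * (M * energy M (g t) (g' t))"
    proof (intro add_mono mult_left_mono two_norms_le_energy M)
      have "0 \<le> r" using \<rho>[OF t] norm_ge_zero order_trans by blast
      then show "2 * (r * (norm (g' t))\<^sup>2) / M\<^sup>2 \<le> 2 * r * energy M (g t) (g' t)"
        by (simp add: energy_def algebra_simps)
      show "0 \<le> e" using \<phi>[OF t] norm_ge_zero order_trans by blast
    qed
    finally show "(e * M + 2 * r) * - energy M (g t) (g' t) \<le> - E' t"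
      by (simp add: algebra_simps)
  qed
  then show ?thesis by simp
qed

lemma inner_mult_left_le:
  fixes x y c :: complex
  assumes "norm c \<le> B"
  shows "\<bar>x \<bullet> (c * y)\<bar> \<le> B * (norm x * norm y)"
proof -
  have "\<bar>x \<bullet> (c * y)\<bar> \<le> norm x * (norm c * norm y)"
    using Cauchy_Schwarz_ineq2[of x "c * y"] by (simp add: norm_mult)
  also have "\<dots> \<le> norm x * (B * norm y)"
    using assms by (intro mult_left_mono mult_right_mono) auto
  finally show ?thesis by (simp add: algebra_simps)
qed

text \<open>Here \<open>x\<close>, \<open>y\<close>, \<open>z\<close> stand for \<open>g\<close>,
  \<open>g'\<close>, \<open>g''\<close>. If \<open>\<phi> = 1\<close> and \<open>\<rho> = 0\<close>,
  the mode \<open>A = y + M x\<close> satisfies \<open>A' = M A\<close>, which gives the first term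
  on the right; the subtracted term bounds the perturbation.\<close>

lemma growing_mode_derivative_ge:
  fixes x y \<rho> \<phi> :: complex
  assumes M: "M > 0" and \<phi>: "norm (\<phi> - 1) \<le> e" and \<rho>: "norm \<rho> \<le> r"
  defines "z \<equiv> \<rho> * y + of_real (M\<^sup>2) * \<phi> * x"
  shows "2 * ((y + of_real M * x) \<bullet> (z + of_real M * y)) \<ge> 2 * M * (norm (y + of_real M * x))\<^sup>2
    - (e + r / M) * M * (2 * M\<^sup>2 * energy M x y + (norm (y + of_real M * x))\<^sup>2)"
proof -
  define A where "A = y + of_real M * x"
  \<comment> \<open>One relative error for both perturbations: \<open>\<rho> * y\<close> and
    \<open>M\<^sup>2 * (\<phi> - 1) * x\<close> together are at most
    \<open>k * M * (norm y + M * norm x)\<close>.\<close>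
  define k where "k = e + r / M"
  have e: "0 \<le> e" and r: "0 \<le> r" using \<phi> \<rho> norm_ge_zero order_trans by blast+
  have k: "e \<le> k" "r \<le> k * M" "0 \<le> k"
    using e r M by (auto simp: k_def field_simps)
  have z: "z + of_real M * y = M *\<^sub>R A + (\<rho> * y + M\<^sup>2 *\<^sub>R ((\<phi> - 1) * x))"
    by (simp add: z_def A_def scaleR_conv_of_real algebra_simps power2_eq_square)
  define q where "q = norm y + M * norm x"
  have "\<bar>A \<bullet> (\<rho> * y)\<bar> \<le> k * M * (norm A * norm y)"
    using inner_mult_left_le[OF order_trans[OF \<rho> k(2)]] .
  moreover have "\<bar>A \<bullet> ((\<phi> - 1) * x)\<bar> \<le> k * (norm A * norm x)"
    using inner_mult_left_le[OF order_trans[OF \<phi> k(1)]] .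
  then have "M\<^sup>2 * \<bar>A \<bullet> ((\<phi> - 1) * x)\<bar> \<le> M\<^sup>2 * (k * (norm A * norm x))"
    by (intro mult_left_mono) auto
  then have "\<bar>M\<^sup>2 * (A \<bullet> ((\<phi> - 1) * x))\<bar> \<le> M\<^sup>2 * (k * (norm A * norm x))"
    by (simp add: abs_mult)
  ultimately have 1: "A \<bullet> (\<rho> * y) + M\<^sup>2 * (A \<bullet> ((\<phi> - 1) * x)) \<ge> - (k * M * (norm A * q))"
    unfolding q_def by (simp add: algebra_simps power2_eq_square abs_le_iff)
  have "2 * (norm A * q) \<le> (norm A)\<^sup>2 + q\<^sup>2"
    using sum_squares_bound[of "norm A" q] by simp
  also have "q\<^sup>2 \<le> 2 * M\<^sup>2 * energy M x y"
  proof -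
    have "2 * M\<^sup>2 * energy M x y - q\<^sup>2 = (norm y - M * norm x)\<^sup>2"
      using M by (simp add: energy_def q_def field_simps power2_eq_square)
    then show ?thesis by (metis diff_ge_0_iff_ge zero_le_power2)
  qed
  finally have "k * M * (2 * (norm A * q)) \<le> k * M * (2 * M\<^sup>2 * energy M x y + (norm A)\<^sup>2)"
    using k M by (intro mult_left_mono) (auto simp: algebra_simps)
  with 1 have "2 * (A \<bullet> (z + of_real M * y)) \<ge> 2 * M * (norm A)\<^sup>2
    - k * M * (2 * M\<^sup>2 * energy M x y + (norm A)\<^sup>2)"
    unfolding z by (simp add: inner_add_right power2_norm_eq_inner)
  then show ?thesis by (simp only: A_def k_def)
qed

text \<open>With \<open>x = g\<close> and \<open>y = g'\<close> the left side is the second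
  derivative of \<open>|g|\<^sup>2\<close>. Unperturbed it equals
  \<open>2 * M\<^sup>2 * energy M x y\<close>; the bound \<open>k\<close> keeps the perturbation to
  at most half of this.\<close>

lemma second_derivative_norm_power2_ge:
  fixes x y \<rho> \<phi> :: complex
  assumes M: "M > 0" and \<phi>: "norm (\<phi> - 1) \<le> e" and \<rho>: "norm \<rho> \<le> r" and k: "e + r / M \<le> 1 / 3"
  shows "2 * (y \<bullet> y + x \<bullet> (\<rho> * y + of_real (M\<^sup>2) * \<phi> * x)) \<ge> M\<^sup>2 * energy M x y"
proof -
  have e: "0 \<le> e" and r: "0 \<le> r" using \<phi> \<rho> norm_ge_zero order_trans by blast+
  then have re: "r \<le> (1 / 3 - e) * M" using k M by (simp add: field_simps)
  have en: "0 \<le> energy M x y" by (simp add: energy_def)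
  have *: "\<rho> * y + of_real (M\<^sup>2) * \<phi> * x = \<rho> * y + M\<^sup>2 *\<^sub>R ((\<phi> - 1) * x) + M\<^sup>2 *\<^sub>R x"
    by (simp add: scaleR_conv_of_real algebra_simps)
  have 1: "2 * (x \<bullet> (\<rho> * y)) \<ge> - ((1 / 3 - e) * M\<^sup>2 * energy M x y)"
  proof -
    have "\<bar>x \<bullet> (\<rho> * y)\<bar> \<le> (1 / 3 - e) * M * (norm x * norm y)"
      using inner_mult_left_le[OF order_trans[OF \<rho> re]] .
    moreover have "(1 / 3 - e) * M * (2 * norm x * norm y) \<le> (1 / 3 - e) * M * (M * energy M x y)"
      using re r two_norms_le_energy[OF M] by (intro mult_left_mono) auto
    ultimately show ?thesis by (simp add: power2_eq_square algebra_simps abs_le_iff)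
  qed
  have 2: "M\<^sup>2 * (x \<bullet> ((\<phi> - 1) * x)) \<ge> - (e * (M\<^sup>2 * energy M x y))"
  proof -
    have "\<bar>x \<bullet> ((\<phi> - 1) * x)\<bar> \<le> e * (norm x * norm x)"
      using inner_mult_left_le[OF \<phi>] .
    also have "\<dots> \<le> e * energy M x y"
      using e by (intro mult_left_mono) (auto simp: energy_def power2_eq_square)
    finally have "M\<^sup>2 * (- (e * energy M x y)) \<le> M\<^sup>2 * (x \<bullet> ((\<phi> - 1) * x))"
      by (intro mult_left_mono) auto
    then show ?thesis by (simp add: mult.left_commute)
  qed
  have 3: "y \<bullet> y + M\<^sup>2 * (x \<bullet> x) = M\<^sup>2 * energy M x y"
    using M by (simp add: energy_def field_simps power2_norm_eq_inner)
  have "2 * (y \<bullet> y + x \<bullet> (\<rho> * y + of_real (M\<^sup>2) * \<phi> * x))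
      = 2 * (M\<^sup>2 * energy M x y) + 2 * (x \<bullet> (\<rho> * y)) + 2 * (M\<^sup>2 * (x \<bullet> ((\<phi> - 1) * x)))"
    unfolding * 3[symmetric] by (simp add: inner_add_right)
  moreover have "(1 / 3 - e) * M\<^sup>2 * energy M x y + 2 * (e * (M\<^sup>2 * energy M x y))
      \<le> M\<^sup>2 * energy M x y"
  proof -
    have "e \<le> 1 / 3" using re M r by (meson diff_ge_0_iff_ge order_trans zero_le_mult_iff not_less)
    then have "(1 / 3 + e) * (M\<^sup>2 * energy M x y) \<le> 1 * (M\<^sup>2 * energy M x y)"
      using en by (intro mult_right_mono) auto
    then show ?thesis by (simp add: algebra_simps)
  qed
  ultimately show ?thesis using 1 2 by linarith
qed

text \<open>Once \<open>\<Sum>|g|\<^sup>2\<close> starts to increase, the growing mode \<open>g' + M g\<close> carries at least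
  half of the energy.\<close>

lemma exponential_growth:
  fixes g1 g1' g2 g2' :: "real \<Rightarrow> complex"
  assumes M: "M > 0"
    and g1: "\<And>t. 0 \<le> t \<Longrightarrow> t \<le> Y \<Longrightarrow> (g1 has_vector_derivative g1' t) (at t)"
    and g1': "\<And>t. 0 \<le> t \<Longrightarrow> t \<le> Y \<Longrightarrow>
      (g1' has_vector_derivative (\<rho> t * g1' t + of_real (M\<^sup>2) * \<phi> t * g1 t)) (at t)"
    and g2: "\<And>t. 0 \<le> t \<Longrightarrow> t \<le> Y \<Longrightarrow> (g2 has_vector_derivative g2' t) (at t)"
    and g2': "\<And>t. 0 \<le> t \<Longrightarrow> t \<le> Y \<Longrightarrow>
      (g2' has_vector_derivative (\<rho> t * g2' t + of_real (M\<^sup>2) * \<phi> t * g2 t)) (at t)"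
    and \<phi>: "\<And>t. 0 \<le> t \<Longrightarrow> t \<le> Y \<Longrightarrow> norm (\<phi> t - 1) \<le> e"
    and \<rho>: "\<And>t. 0 \<le> t \<Longrightarrow> t \<le> Y \<Longrightarrow> norm (\<rho> t) \<le> r"
    and k: "e + r / M \<le> 1 / 3"
    and init: "g1 0 \<bullet> g1' 0 + g2 0 \<bullet> g2' 0 \<ge> 0"
    and h: "0 \<le> h" "h + 2 * \<delta> \<le> Y" and \<delta>: "\<delta> > 0"
  shows "(norm (g1 Y))\<^sup>2 + (norm (g2 Y))\<^sup>2 \<ge> \<delta>\<^sup>2 / 4 * M\<^sup>2 * exp (M * \<delta>)
    * (energy M (g1 h) (g1' h) + energy M (g2 h) (g2' h))"
proof -
  define E where "E t = energy M (g1 t) (g1' t) + energy M (g2 t) (g2' t)" for t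
  define z1 where "z1 t = \<rho> t * g1' t + of_real (M\<^sup>2) * \<phi> t * g1 t" for t
  define z2 where "z2 t = \<rho> t * g2' t + of_real (M\<^sup>2) * \<phi> t * g2 t" for t
  define F where "F t = (norm (g1 t))\<^sup>2 + (norm (g2 t))\<^sup>2" for t
  define p where "p t = 2 * (g1 t \<bullet> g1' t + g2 t \<bullet> g2' t)" for t
  define p' where "p' t = 2 * (g1' t \<bullet> g1' t + g1 t \<bullet> z1 t) + 2 * (g2' t \<bullet> g2' t + g2 t \<bullet> z2 t)" for t
  define A1 where "A1 t = g1' t + of_real M * g1 t" for t
  define A2 where "A2 t = g2' t + of_real M * g2 t" for t
  define J where "J t = (norm (A1 t))\<^sup>2 + (norm (A2 t))\<^sup>2" for t
  define J' where "J' t = 2 * (A1 t \<bullet> (z1 t + of_real M * g1' t))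
    + 2 * (A2 t \<bullet> (z2 t + of_real M * g2' t))" for t
  have E0: "E t \<ge> 0" for t by (simp add: E_def energy_def)
  have DF: "(F has_real_derivative p t) (at t)" if "0 \<le> t" "t \<le> Y" for t
    unfolding F_def p_def
    using DERIV_add[OF has_real_derivative_norm_power2[OF g1[OF that]]
        has_real_derivative_norm_power2[OF g2[OF that]]] by (simp add: algebra_simps)
  have Dp: "(p has_real_derivative p' t) (at t)" if "0 \<le> t" "t \<le> Y" for t
    using DERIV_cmult[OF DERIV_add[OF has_real_derivative_inner[OF g1[OF that] g1'[OF that]]
        has_real_derivative_inner[OF g2[OF that] g2'[OF that]]], of 2]
    unfolding p_def p'_def z1_def z2_def by (simp add: algebra_simps)
  have DA1: "(A1 has_vector_derivative z1 t + of_real M * g1' t) (at t)" if "0 \<le> t" "t \<le> Y" for t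
    unfolding A1_def z1_def
    by (intro has_vector_derivative_add has_vector_derivative_mult_right g1 g1' that)
  have DA2: "(A2 has_vector_derivative z2 t + of_real M * g2' t) (at t)" if "0 \<le> t" "t \<le> Y" for t
    unfolding A2_def z2_def
    by (intro has_vector_derivative_add has_vector_derivative_mult_right g2 g2' that)
  have DJ: "(J has_real_derivative J' t) (at t)" if "0 \<le> t" "t \<le> Y" for t
    unfolding J_def J'_def
    by (intro DERIV_add has_real_derivative_norm_power2 DA1 DA2 that)
  \<comment> \<open>So \<open>F\<close> is convex, and its derivative \<open>p\<close>, nonnegative
    at \<open>0\<close> by \<open>init\<close>, stays nonnegative.\<close>
  have p'E: "p' t \<ge> M\<^sup>2 * E t" if "0 \<le> t" "t \<le> Y" for t
    using second_derivative_norm_power2_ge[OF M \<phi>[OF that] \<rho>[OF that] k, where y = "g1' t" and x = "g1 t"]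
      second_derivative_norm_power2_ge[OF M \<phi>[OF that] \<rho>[OF that] k, where y = "g2' t" and x = "g2 t"]
    unfolding p'_def E_def z1_def z2_def distrib_left by linarith
  then have p'0: "p' t \<ge> 0" if "0 \<le> t" "t \<le> Y" for t
    using E0[of t] that by (meson order_trans mult_nonneg_nonneg zero_le_power2)
  have p0: "p t \<ge> 0" if t: "0 \<le> t" "t \<le> Y" for t
  proof -
    have "p 0 \<le> p t"
      using t by (intro DERIV_nonneg_imp_nondecreasing[OF t(1)])
        (meson Dp p'0 order_trans)
    then show ?thesis using init by (simp add: p_def)
  qed
  \<comment> \<open>As \<open>p\<close> is nonnegative, \<open>M\<^sup>2 * E t \<le> J t\<close>.
    The opposite bound \<open>J2\<close> holds because \<open>2 * M\<^sup>2 * E t - J t\<close> is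
    the squared size of the decaying mode \<open>g' - M g\<close>.\<close>
  have JE: "J t = M\<^sup>2 * E t + M * p t" for t
    unfolding J_def E_def p_def A1_def A2_def distrib_left energy_scaled[OF M] norm_add_mult_power2
    by (simp add: algebra_simps)
  \<comment> \<open>Of the ideal rate \<open>2 * M\<close> one \<open>M\<close> is given up to the
    perturbation, whose coefficient \<open>e + r / M\<close> is at most
    \<open>1 / 3\<close>.\<close>
  have J'J: "J' t \<ge> M * J t" if t: "0 \<le> t" "t \<le> Y" for t
  proof -
    have "2 * M * J t - (e + r / M) * M * (2 * M\<^sup>2 * E t + J t) \<le> J' t"
      using growing_mode_derivative_ge[OF M \<phi>[OF t] \<rho>[OF t], where y = "g1' t" and x = "g1 t"]
        growing_mode_derivative_ge[OF M \<phi>[OF t] \<rho>[OF t], where y = "g2' t" and x = "g2 t"]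
      unfolding J'_def J_def A1_def A2_def E_def z1_def z2_def by (simp add: algebra_simps)
    moreover have "2 * M\<^sup>2 * E t + J t \<le> 3 * J t"
      using JE[of t] p0[OF t] M by simp
    then have "(e + r / M) * M * (2 * M\<^sup>2 * E t + J t) \<le> 1 / 3 * M * (3 * J t)"
      using k M E0[of t] by (intro mult_mono) (auto simp: J_def)
    ultimately show ?thesis by (simp add: algebra_simps)
  qed
  have J2: "J t \<le> 2 * (M\<^sup>2 * E t)" for t
  proof -
    have "2 * (M\<^sup>2 * E t) - J t = (norm (g1' t - of_real M * g1 t))\<^sup>2 + (norm (g2' t - of_real M * g2 t))\<^sup>2"
      using norm_add_mult_power2[of "g1' t" "- M" "g1 t"] norm_add_mult_power2[of "g2' t" "- M" "g2 t"]
      unfolding JE E_def p_def distrib_left energy_scaled[OF M] by (simp add: algebra_simps)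
    then show ?thesis by (metis diff_ge_0_iff_ge add_nonneg_nonneg zero_le_power2)
  qed
  \<comment> \<open>Between \<open>h\<close> and any time after \<open>s = Y - \<delta>\<close> the
    growing mode gains at least \<open>exp (M * \<delta>)\<close>. On \<open>[s, Y]\<close> the
    resulting bound \<open>C\<close> for \<open>p'\<close> is integrated twice, giving
    \<open>C * \<delta>\<^sup>2 / 2\<close>.\<close>
  define C where "C = M\<^sup>2 / 2 * exp (M * \<delta>) * E h"
  define s where "s = Y - \<delta>"
  have s: "0 \<le> s" "s \<le> Y" "h + \<delta> \<le> s" "h \<le> Y" using h \<delta> by (auto simp: s_def)
  have p'C: "C \<le> p' t" if t: "s \<le> t" "t \<le> Y" for t
  proof -
    have ht: "h \<le> t" "0 \<le> t" using s t \<delta> h by auto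
    have "J h * exp (M * (t - h)) \<le> J t"
      by (rule nondecreasing_exp_weight[OF ht(1)])
        (use DJ J'J t h in \<open>auto intro: order_trans\<close>)
    moreover have "M\<^sup>2 * E h * exp (M * \<delta>) \<le> J h * exp (M * (t - h))"
      using JE[of h] p0[of h] h s t M E0[of h] by (intro mult_mono) auto
    ultimately have "M\<^sup>2 * E h * exp (M * \<delta>) \<le> 2 * p' t"
      using J2[of t] p'E[OF ht(2) t(2)] by linarith
    then show ?thesis by (simp add: C_def algebra_simps)
  qed
  have pC: "C * (t - s) \<le> p t" if t: "s \<le> t" "t \<le> Y" for t
  proof -
    have "p s - C * (s - s) \<le> p t - C * (t - s)"
    proof (rule DERIV_nonneg_imp_nondecreasing[OF t(1)])
      fix x assume x: "s \<le> x" "x \<le> t"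
      have "((\<lambda>t. p t - C * (t - s)) has_real_derivative p' x - C) (at x)"
        using x t s by (auto intro!: derivative_eq_intros Dp)
      then show "\<exists>y. ((\<lambda>t. p t - C * (t - s)) has_real_derivative y) (at x) \<and> 0 \<le> y"
        using p'C[of x] x t by (intro exI[of _ "p' x - C"]) auto
    qed
    then show ?thesis using p0[OF s(1,2)] by simp
  qed
  have "F s - C * (s - s)\<^sup>2 / 2 \<le> F Y - C * (Y - s)\<^sup>2 / 2"
  proof (rule DERIV_nonneg_imp_nondecreasing[OF s(2)])
    fix x assume x: "s \<le> x" "x \<le> Y"
    have "((\<lambda>t. F t - C * (t - s)\<^sup>2 / 2) has_real_derivative p x - C * (x - s)) (at x)"
      using x s by (auto intro!: derivative_eq_intros DF)
    then show "\<exists>y. ((\<lambda>t. F t - C * (t - s)\<^sup>2 / 2) has_real_derivative y) (at x) \<and> 0 \<le> y"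
      using pC[of x] x by (intro exI[of _ "p x - C * (x - s)"]) auto
  qed
  moreover have "F s \<ge> 0" by (simp add: F_def)
  ultimately have "C * \<delta>\<^sup>2 / 2 \<le> F Y"
    by (simp add: s_def)
  then show ?thesis
    by (simp add: F_def C_def E_def algebra_simps)
qed

subsection \<open>Points where an entire function looks like a power\<close>

text \<open>Some Taylor coefficient of order \<open>k > 0\<close> is nonzero. If \<open>|P|\<close>
  stayed below \<open>c * r\<close> on the circle of radius \<open>r\<close>, Cauchy's inequality
  would make this coefficient at most half its actual size.\<close>

lemma entire_nonconstant_growth:
  assumes hol: "P holomorphic_on UNIV" and nc: "\<not> P constant_on UNIV"
  obtains c where "c > 0" "\<And>r. r \<ge> 1 \<Longrightarrow> \<exists>z. norm z = r \<and> norm (P z) \<ge> c * r"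
proof -
  obtain k where k: "k > 0" "(deriv ^^ k) P 0 \<noteq> 0"
  proof (rule ccontr)
    assume "\<not> thesis"
    with that have "(deriv ^^ n) P 0 = 0" if "0 < n" for n using \<open>0 < n\<close> by blast
    then have "P w = P 0" for w
      by (intro holomorphic_fun_eq_const_on_connected[OF hol]) auto
    then have "P constant_on UNIV" unfolding constant_on_def by blast
    with nc show False by blast
  qed
  define c where "c = norm ((deriv ^^ k) P 0) / (2 * fact k)"
  have "c > 0" using k by (simp add: c_def)
  moreover have "\<exists>z. norm z = r \<and> norm (P z) \<ge> c * r" if r: "r \<ge> 1" for r
  proof (rule ccontr)
    assume "\<not> ?thesis"
    then have *: "norm (P z) \<le> c * r" if "norm (0 - z) = r" for z
      using that by (auto simp: not_le intro: less_imp_le)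
    have "norm ((deriv ^^ k) P 0) \<le> fact k * (c * r) / r ^ k"
      using hol r holomorphic_on_imp_continuous_on[OF hol]
      by (intro Cauchy_inequality *) (auto intro: holomorphic_on_subset continuous_on_subset)
    also have "\<dots> \<le> fact k * (c * r) / r ^ 1"
      using r k \<open>c > 0\<close> by (intro divide_left_mono power_increasing) auto
    also have "\<dots> = norm ((deriv ^^ k) P 0) / 2"
      using r by (simp add: c_def)
    finally show False using k by simp
  qed
  ultimately show thesis using that by blast
qed

text \<open>Schwarz's lemma, applied after the Moebius map of the disc of radius \<open>B\<close>
  onto the unit disc that sends \<open>1\<close> to \<open>0\<close>. A bound \<open>B\<close> close
  to \<open>1\<close> thus keeps \<open>\<phi>\<close> close to its value at the centre.\<close>

lemma bounded_holomorphic_near_one: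
  assumes hol: "\<phi> holomorphic_on ball 0 R" and R: "R > 0" and 0: "\<phi> 0 = 1" and B: "B > 1"
    and less: "\<And>t. norm t < R \<Longrightarrow> norm (\<phi> t) < B" and t: "norm t \<le> R / 2"
  shows "norm (\<phi> t - 1) \<le> B\<^sup>2 - 1"
proof -
  define g where "g s = of_real B * (\<phi> (of_real R * s) - 1) / (of_real (B\<^sup>2) - \<phi> (of_real R * s))" for s
  have B2: "B < B\<^sup>2" using B by (simp add: power2_eq_square)
  have in_ball: "norm (of_real R * s) < R" if "norm s < 1" for s :: complex
    using that R by (simp add: norm_mult)
  have ne: "of_real (B\<^sup>2) - \<phi> (of_real R * s) \<noteq> 0" if "norm s < 1" for s
  proof
    assume "of_real (B\<^sup>2) - \<phi> (of_real R * s) = 0"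
    then have "norm (\<phi> (of_real R * s)) = norm (of_real (B\<^sup>2) :: complex)" by simp
    then have "norm (\<phi> (of_real R * s)) = B\<^sup>2" by (simp only: norm_of_real) simp
    with less[OF in_ball[OF that]] B2 show False by simp
  qed
  have "g holomorphic_on ball 0 1"
  proof -
    have "(\<phi> \<circ> (\<lambda>s. of_real R * s)) holomorphic_on ball 0 1"
      by (rule holomorphic_on_compose_gen[OF _ hol]) (use in_ball in \<open>auto intro!: holomorphic_intros\<close>)
    then have "(\<lambda>s. \<phi> (of_real R * s)) holomorphic_on ball 0 1" by (simp add: o_def)
    then show ?thesis unfolding g_def
      by (intro holomorphic_intros) (use ne in auto)
  qed
  moreover have "g 0 = 0" by (simp add: g_def 0)
  moreover have "norm (g s) < 1" if s: "norm s < 1" for s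
  proof -
    define x where "x = \<phi> (of_real R * s)"
    \<comment> \<open>The right side is positive for \<open>norm x < B\<close>: the Moebius map
      takes the disc of radius \<open>B\<close> into the unit disc.\<close>
    have "(norm (of_real (B\<^sup>2) - x))\<^sup>2 - (norm (of_real B * (x - 1)))\<^sup>2 = (B\<^sup>2 - 1) * (B\<^sup>2 - (norm x)\<^sup>2)"
      by (simp add: cmod_power2 norm_mult power_mult_distrib) algebra
    moreover have "(norm x)\<^sup>2 < B\<^sup>2"
      using less[OF in_ball[OF s]] by (intro power_strict_mono) (auto simp: x_def)
    ultimately have "(norm (of_real B * (x - 1)))\<^sup>2 < (norm (of_real (B\<^sup>2) - x))\<^sup>2"
      using B B2 by (smt (verit) mult_pos_pos)
    then have "norm (of_real B * (x - 1)) < norm (of_real (B\<^sup>2) - x)"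
      using power2_less_imp_less norm_ge_zero by blast
    then show ?thesis using ne[OF s] by (simp add: g_def norm_divide x_def)
  qed
  moreover have tR: "norm (t / of_real R) < 1" using t R by (simp add: norm_divide field_simps)
  ultimately have "norm (g (t / of_real R)) \<le> norm (t / of_real R)"
    by (rule Schwarz_Lemma(1))
  also have "\<dots> \<le> 1 / 2" using t R by (simp add: norm_divide field_simps)
  finally have "norm (g (t / of_real R)) \<le> 1 / 2" .
  then have "norm (of_real B * (\<phi> t - 1)) / norm (of_real (B\<^sup>2) - \<phi> t) \<le> 1 / 2"
    using R by (simp add: g_def norm_divide)
  then have "2 * norm (of_real B * (\<phi> t - 1)) \<le> norm (of_real (B\<^sup>2) - \<phi> t)"
    using ne[OF tR] R by (simp add: pos_divide_le_eq)
  then have "2 * (B * norm (\<phi> t - 1)) \<le> norm (of_real (B\<^sup>2) - \<phi> t)"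
    using B by (simp add: norm_mult)
  also have "\<dots> \<le> norm (of_real (B\<^sup>2 - 1) :: complex) + norm (\<phi> t - 1)"
    using norm_triangle_ineq4[of "of_real (B\<^sup>2 - 1)" "\<phi> t - 1"] by simp
  also have "norm (of_real (B\<^sup>2 - 1) :: complex) = B\<^sup>2 - 1"
    using B B2 by (simp only: norm_of_real)
  finally have "2 * (B * norm (\<phi> t - 1)) \<le> B\<^sup>2 - 1 + norm (\<phi> t - 1)" .
  moreover have "1 * norm (\<phi> t - 1) \<le> B * norm (\<phi> t - 1)"
    using B by (intro mult_right_mono) auto
  ultimately show ?thesis by simp
qed

text \<open>A point maximising \<open>|P z| (2 n - ln |z|)\<^sup>n\<close>: the maximality bounds \<open>|P|\<close> near
  that point by a power of \<open>|z|\<close>, which replaces Wiman-Valiron theory.\<close>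

lemma power_like_point:
  assumes hol: "P holomorphic_on UNIV" and nc: "\<not> P constant_on UNIV"
    and R: "R > 0" and \<epsilon>: "\<epsilon> > 0"
  obtains z0 N where "N \<ge> 1 / 2" "z0 \<noteq> 0" "P z0 \<noteq> 0"
    "T \<le> norm (P z0) * (norm z0)\<^sup>2 / N\<^sup>2"
    "\<And>t. norm t \<le> R \<Longrightarrow> norm (P (z0 * exp (t / of_real N)) * exp (- t) / P z0 - 1) \<le> \<epsilon>"
proof -
  obtain c where c: "c > 0" and cr: "\<And>r. r \<ge> 1 \<Longrightarrow> \<exists>z. norm z = r \<and> norm (P z) \<ge> c * r"
    using entire_nonconstant_growth[OF hol nc] by blast
  have cont: "continuous_on S P" for S
    using hol holomorphic_on_imp_continuous_on continuous_on_subset by blast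
  have "bounded (P ` cball 0 (exp (4 * R)))"
    by (intro compact_imp_bounded compact_continuous_image cont compact_cball)
  then obtain B where "\<forall>x\<in>P ` cball 0 (exp (4 * R)). norm x \<le> B"
    unfolding bounded_iff by blast
  then have B: "norm (P z) \<le> B" if "norm z \<le> exp (4 * R)" for z
    using that by simp
  \<comment> \<open>The third condition keeps the maximum point away from the inner circle, the
    fourth yields the bound by \<open>T\<close>, the last the bound by \<open>\<epsilon>\<close>.
    The powers grow because \<open>exp 1 > 2\<close>.\<close>
  have "\<forall>\<^sub>F n::nat in sequentially. n \<ge> 2 \<and> real n > 4 * R \<and> c * (exp 1 / 2) ^ n > B
      \<and> 4 * c * (exp 1 / 2) ^ n \<ge> T \<and> exp (24 * R\<^sup>2 / real n) - 1 \<le> \<epsilon>"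
  proof (intro eventually_conj)
    have "(3 / 2 :: real)\<^sup>2 \<le> (exp (1 / 2))\<^sup>2"
      using exp_ge_add_one_self[of "1 / 2 :: real"] by (intro power_mono) auto
    also have "(exp (1 / 2 :: real))\<^sup>2 = exp 1"
      using exp_double[of "1 / 2 :: real"] by simp
    finally have e2: "(exp 1 / 2 :: real) > 1"
      by (simp add: power2_eq_square)
    have lim: "filterlim (\<lambda>n. (exp 1 / 2 :: real) ^ n) at_top sequentially"
    proof (rule filterlim_at_infinity_imp_filterlim_at_top)
      show "filterlim (\<lambda>n. (exp 1 / 2 :: real) ^ n) at_infinity sequentially"
        by (rule filterlim_realpow_sequentially_gt1) (use e2 in simp)
    qed simp
    show "\<forall>\<^sub>F n in sequentially. (2::nat) \<le> n" by (rule eventually_ge_at_top)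
    show "\<forall>\<^sub>F n in sequentially. 4 * R < real n"
      using filterlim_real_sequentially filterlim_at_top_dense by blast
    have "\<forall>\<^sub>F n in sequentially. B / c < (exp 1 / 2) ^ n"
      using lim filterlim_at_top_dense by blast
    then show "\<forall>\<^sub>F n in sequentially. B < c * (exp 1 / 2) ^ n"
      by eventually_elim (use c in \<open>simp add: field_simps\<close>)
    have "\<forall>\<^sub>F n in sequentially. T / (4 * c) < (exp 1 / 2) ^ n"
      using lim filterlim_at_top_dense by blast
    then show "\<forall>\<^sub>F n in sequentially. T \<le> 4 * c * (exp 1 / 2) ^ n"
      by eventually_elim (use c in \<open>simp add: field_simps\<close>)
    have "(\<lambda>n. exp (24 * R\<^sup>2 / real n) - 1) \<longlonglongrightarrow> exp 0 - 1"
      by (intro tendsto_intros lim_const_over_n)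
    then have "\<forall>\<^sub>F n in sequentially. exp (24 * R\<^sup>2 / real n) - 1 < \<epsilon>"
      using \<epsilon> by (intro order_tendstoD) auto
    then show "\<forall>\<^sub>F n in sequentially. exp (24 * R\<^sup>2 / real n) - 1 \<le> \<epsilon>"
      by eventually_elim simp
  qed
  then obtain n :: nat where n: "n \<ge> 2" "real n > 4 * R" "c * (exp 1 / 2) ^ n > B"
      "4 * c * (exp 1 / 2) ^ n \<ge> T" "exp (24 * R\<^sup>2 / real n) - 1 \<le> \<epsilon>"
    by (auto dest: eventually_happens)
  define K where "K = cball 0 (exp (2 * n)) - ball (0::complex) 1"
  \<comment> \<open>The second factor vanishes on the outer circle
    \<open>norm z = exp (2 * n)\<close>, so the maximum over \<open>K\<close> is not attained
    there.\<close>
  define H where "H z = norm (P z) * (2 * n - ln (norm z)) ^ n" for z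
  have K: "z \<in> K \<longleftrightarrow> 1 \<le> norm z \<and> norm z \<le> exp (2 * n)" for z by (auto simp: K_def)
  \<comment> \<open>At radius \<open>exp n\<close> the second factor of \<open>H\<close> is
    \<open>n ^ n\<close>; this test point bounds the maximum from below.\<close>
  obtain z1 where z1: "norm z1 = exp n" "norm (P z1) \<ge> c * exp n" using cr[of "exp n"] by auto
  have "z1 \<in> K" using z1 by (simp add: K)
  have "continuous_on K H" unfolding H_def
    by (intro continuous_intros cont) (auto simp: K)
  moreover have "compact K" unfolding K_def by (intro compact_diff) auto
  ultimately obtain z0 where z0: "z0 \<in> K" "\<And>z. z \<in> K \<Longrightarrow> H z \<le> H z0"
    using continuous_attains_sup[of K H] \<open>z1 \<in> K\<close> by blast
  define s where "s = ln (norm z0)"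
  define a where "a = 2 * real n - s"
  have norm_z0: "norm z0 = exp s" using z0(1) unfolding K s_def by (subst exp_ln) auto
  have s: "0 \<le> s" "s \<le> 2 * n" using z0(1) norm_z0 by (auto simp: K)
  have H0: "c * exp n * real n ^ n \<le> norm (P z0) * a ^ n"
  proof -
    have "c * exp n * real n ^ n \<le> H z1"
      using z1 by (simp add: H_def mult_right_mono)
    also have "\<dots> \<le> H z0" using z0(2) \<open>z1 \<in> K\<close> .
    finally show ?thesis by (simp add: H_def a_def s_def)
  qed
  have pos: "0 < c * exp n * real n ^ n" using c n by simp
  then have P0: "P z0 \<noteq> 0" and a0: "a \<noteq> 0" using H0 n by (auto simp: power_0_left)
  have a: "0 < a" "a \<le> 2 * n" using a0 s by (auto simp: a_def)
  \<comment> \<open>At an interior maximum of \<open>H\<close> the derivative of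
    \<open>ln |P|\<close> with respect to \<open>ln |z|\<close> is \<open>n / a\<close>, which
    identifies the exponent of the approximating power.\<close>
  define N where "N = real n / a"
  have N: "N \<ge> 1 / 2" using a by (simp add: N_def field_simps)
  \<comment> \<open>Near the inner circle \<open>|P|\<close> is at most \<open>B\<close>, so
    \<open>H z0\<close> would be at most \<open>B * (2 * n) ^ n\<close>, less than the value at
    \<open>z1\<close> by the choice of \<open>n\<close>.\<close>
  have sR: "s > 4 * R"
  proof (rule ccontr)
    assume "\<not> ?thesis"
    then have PB: "norm (P z0) \<le> B" by (intro B) (simp add: norm_z0)
    have "c * exp n * real n ^ n \<le> B * (2 * real n) ^ n"
      using a PB order_trans[OF norm_ge_zero PB]
      by (intro order_trans[OF H0] mult_mono power_mono) auto
    then have "c * exp 1 ^ n \<le> B * 2 ^ n"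
      using n by (simp add: power_mult_distrib flip: exp_of_nat_mult)
    then show False using n(3) by (simp add: power_divide field_simps)
  qed
  show thesis
  proof (rule that[of N z0])
    show "N \<ge> 1 / 2" "P z0 \<noteq> 0" by fact+
    show "z0 \<noteq> 0" using norm_z0 by auto
    have "T \<le> 4 * c * (exp 1 / 2) ^ n" by fact
    also have "\<dots> \<le> norm (P z0) * a\<^sup>2 / n\<^sup>2"
    proof -
      \<comment> \<open>As \<open>a / (2 * n) \<le> 1\<close> and \<open>n \<ge> 2\<close>, the
        power \<open>a ^ n\<close> can be traded for \<open>a\<^sup>2\<close>, which is what
        division by \<open>N\<^sup>2\<close> leaves.\<close>
      have "(a / (2 * n)) ^ n \<le> (a / (2 * n))\<^sup>2"
        using a n by (intro power_decreasing) auto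
      then have "a ^ n * (2 * real n)\<^sup>2 \<le> a\<^sup>2 * (2 * real n) ^ n"
        using n by (simp add: power_divide field_simps)
      then have "norm (P z0) * (a ^ n * (2 * real n)\<^sup>2) \<le> norm (P z0) * (a\<^sup>2 * (2 * real n) ^ n)"
        by (intro mult_left_mono) auto
      moreover have "c * exp n * real n ^ n * (2 * real n)\<^sup>2 \<le> norm (P z0) * a ^ n * (2 * real n)\<^sup>2"
        using H0 by (intro mult_right_mono) auto
      ultimately have "c * exp n * real n ^ n * (2 * real n)\<^sup>2 \<le> norm (P z0) * (a\<^sup>2 * (2 * real n) ^ n)"
        by (simp add: mult.assoc)
      then have "real n ^ n * (c * exp n * (2 * real n)\<^sup>2) \<le> real n ^ n * (norm (P z0) * a\<^sup>2 * 2 ^ n)"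
        by (simp add: power_mult_distrib algebra_simps)
      then have "c * exp n * (2 * real n)\<^sup>2 \<le> norm (P z0) * a\<^sup>2 * 2 ^ n"
        using n by simp
      then show ?thesis
        using n by (simp add: power_divide power_mult_distrib field_simps flip: exp_of_nat_mult)
    qed
    also have "\<dots> \<le> norm (P z0) * a\<^sup>2 / n\<^sup>2 * (norm z0)\<^sup>2"
      using mult_left_mono[OF one_le_power[of "norm z0" 2], of "norm (P z0) * a\<^sup>2 / n\<^sup>2"] z0(1)
      by (simp add: K)
    finally show "T \<le> norm (P z0) * (norm z0)\<^sup>2 / N\<^sup>2"
      by (simp add: N_def power_divide mult_ac)
    fix t :: complex assume t: "norm t \<le> R"
    define \<phi> where "\<phi> t = P (z0 * exp (t / of_real N)) * exp (- t) / P z0" for t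
    \<comment> \<open>The Schwarz bound is valid on half the radius, hence the disc of radius
      \<open>2 * R\<close>.\<close>
    have "norm (\<phi> t - 1) \<le> (exp (12 * R\<^sup>2 / n))\<^sup>2 - 1"
    proof (rule bounded_holomorphic_near_one[where \<phi> = \<phi> and t = t and R = "2 * R"])
      have "(P \<circ> (\<lambda>t. z0 * exp (t / of_real N))) holomorphic_on ball 0 (2 * R)"
        by (rule holomorphic_on_compose_gen[OF _ hol]) (use N in \<open>auto intro!: holomorphic_intros\<close>)
      then show "\<phi> holomorphic_on ball 0 (2 * R)"
        unfolding \<phi>_def o_def using P0 by (intro holomorphic_intros) auto
      show "\<phi> 0 = 1" using P0 by (simp add: \<phi>_def)
      fix t :: complex assume t: "norm t < 2 * R"
      \<comment> \<open>The displacement of \<open>ln |z|\<close> in units of \<open>a\<close>, so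
        that \<open>2 * n - ln |z| = a * (1 - y)\<close>. Maximality then reads
        \<open>|P z| * (1 - y) ^ n \<le> |P z0|\<close>; as \<open>n * y = Re t\<close>, the
        first-order term cancels against \<open>exp (- t)\<close> and a quadratic error in
        \<open>y\<close> remains.\<close>
      define y where "y = Re t / n"
      have y: "\<bar>y\<bar> \<le> 1 / 2" "\<bar>y\<bar> < 2 * R / n"
        using n t abs_Re_le_cmod[of t] by (auto simp: y_def field_simps)
      define z where "z = z0 * exp (t / of_real N)"
      have norm_z: "norm z = exp (s + Re t / N)"
        by (simp add: z_def norm_mult norm_z0 exp_add)
      have yN: "Re t / N = y * a" using n a by (simp add: y_def N_def field_simps)
      have "\<bar>y\<bar> * a \<le> \<bar>y\<bar> * (2 * n)" using a by (intro mult_left_mono) auto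
      also have "\<dots> < 2 * R / n * (2 * n)" using y n by (intro mult_strict_right_mono) auto
      finally have "\<bar>y\<bar> * a < 2 * R / n * (2 * n)" .
      then have ya: "\<bar>y * a\<bar> < 4 * R" using n a by (simp add: abs_mult)
      have "y * a \<le> 1 * a" using y a by (intro mult_right_mono) auto
      then have zK: "z \<in> K" using ya sR by (simp add: K norm_z yN a_def abs_less_iff)
      have "norm (P z) * (a * (1 - y)) ^ n \<le> norm (P z0) * a ^ n"
        using z0(2)[OF zK] unfolding H_def norm_z yN norm_z0
        by (simp add: a_def algebra_simps)
      then have "a ^ n * (norm (P z) * (1 - y) ^ n) \<le> a ^ n * norm (P z0)"
        unfolding power_mult_distrib by (simp add: mult_ac)
      then have 1: "norm (P z) * (1 - y) ^ n \<le> norm (P z0)" using a by simp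
      have "ln (1 - y) \<ge> - y - 2 * y\<^sup>2"
        using abs_ln_one_plus_x_minus_x_bound[of "- y"] y by (simp add: abs_le_iff)
      moreover have y1: "1 - y > 0" using y by auto
      ultimately have "1 - y \<ge> exp (- y - 2 * y\<^sup>2)"
        using exp_le_cancel_iff exp_ln by metis
      then have "(1 - y) ^ n \<ge> exp (- y - 2 * y\<^sup>2) ^ n" by (intro power_mono) auto
      also have "exp (- y - 2 * y\<^sup>2) ^ n = exp (- Re t - 2 * n * y\<^sup>2)"
        using n by (simp add: y_def algebra_simps flip: exp_of_nat_mult)
      finally have "norm (P z) * exp (- Re t - 2 * n * y\<^sup>2) \<le> norm (P z0)"
        using 1 by (meson mult_left_mono norm_ge_zero order_trans)
      then have "norm (P z) * exp (- Re t) \<le> norm (P z0) * exp (2 * n * y\<^sup>2)"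
        by (simp add: exp_diff field_simps)
      then have "norm (\<phi> t) \<le> exp (2 * n * y\<^sup>2)"
        using P0 by (simp add: \<phi>_def norm_divide norm_mult field_simps flip: z_def)
      also have "\<dots> < exp (12 * R\<^sup>2 / n)"
      proof -
        have "y\<^sup>2 \<le> (2 * R / n)\<^sup>2" using y(2) by (intro power2_le_iff_abs_le[THEN iffD2]) auto
        then have "2 * n * y\<^sup>2 \<le> 2 * n * (2 * R / n)\<^sup>2" by (intro mult_left_mono) auto
        also have "\<dots> = 8 * R\<^sup>2 / n" using n by (simp add: field_simps power2_eq_square)
        also have "\<dots> < 12 * R\<^sup>2 / n" using n R by (simp add: field_simps)
        finally show ?thesis by simp
      qed
      finally show "norm (\<phi> t) < exp (12 * R\<^sup>2 / n)" .
    qed (use R n t in auto)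
    also have "(exp (12 * R\<^sup>2 / n))\<^sup>2 = exp (24 * R\<^sup>2 / n)"
      by (simp flip: exp_of_nat_mult)
    finally show "norm (P (z0 * exp (t / of_real N)) * exp (- t) / P z0 - 1) \<le> \<epsilon>"
      using n(5) by (simp add: \<phi>_def)
  qed
qed

subsection \<open>Comparison along chords\<close>

lemma has_vector_derivative_along_line:
  assumes "(F has_field_derivative F') (at (Z + of_real t * e))"
  shows "((\<lambda>t. F (Z + of_real t * e)) has_vector_derivative e * F') (at t)"
proof -
  have "((\<lambda>t. Z + of_real t * e) has_vector_derivative e) (at t)"
    by (auto intro!: derivative_eq_intros simp: scaleR_conv_of_real)
  from field_vector_diff_chain_at[OF this assms] show ?thesis by (simp add: o_def)
qed

text \<open>A horizontal direction \<open>s\<close> has \<open>s * s = 1\<close>, so the restricted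
  equation keeps its oscillating sign and \<open>oscillatory_energy_le\<close> applies.\<close>

lemma horizontal_energy_le:
  fixes W W' \<rho> \<Phi> :: "complex \<Rightarrow> complex"
  assumes M: "M > 0"
    and W: "\<And>Z. Z \<in> D \<Longrightarrow> (W has_field_derivative W' Z) (at Z)"
    and W': "\<And>Z. Z \<in> D \<Longrightarrow>
      (W' has_field_derivative (\<rho> Z * W' Z - of_real (M\<^sup>2) * \<Phi> Z * W Z)) (at Z)"
    and \<Phi>: "\<And>Z. Z \<in> D \<Longrightarrow> norm (\<Phi> Z - 1) \<le> e"
    and \<rho>: "\<And>Z. Z \<in> D \<Longrightarrow> norm (\<rho> Z) \<le> r"
    and D: "\<And>x. x \<in> closed_segment x0 x1 \<Longrightarrow> Complex x y \<in> D"
  shows "energy M (W (Complex x1 y)) (W' (Complex x1 y))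
    \<le> energy M (W (Complex x0 y)) (W' (Complex x0 y)) * exp ((e * M + 2 * r) * \<bar>x1 - x0\<bar>)"
proof -
  define s :: real where "s = (if x0 \<le> x1 then 1 else -1)"
  define L where "L = \<bar>x1 - x0\<bar>"
  define Z where "Z t = Complex x0 y + of_real t * of_real s" for t
  have s: "s * s = 1" "\<bar>s\<bar> = 1" by (auto simp: s_def)
  have ZD: "Z t \<in> D" if "0 \<le> t" "t \<le> L" for t
  proof -
    have "Z t = Complex (x0 + t * s) y" by (simp add: Z_def complex_eq_iff)
    moreover have "x0 + t * s \<in> closed_segment x0 x1"
      using that by (auto simp: s_def L_def closed_segment_eq_real_ivl split: if_splits)
    ultimately show ?thesis using D by simp
  qed
  have "energy M (W (Z L)) (of_real s * W' (Z L))
      \<le> energy M (W (Z 0)) (of_real s * W' (Z 0)) * exp ((e * M + 2 * r) * L)"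
  proof (rule oscillatory_energy_le[OF M, where \<phi> = "\<lambda>t. \<Phi> (Z t)" and \<rho> = "\<lambda>t. of_real s * \<rho> (Z t)"])
    fix t assume t: "0 \<le> t" "t \<le> L"
    note Zt = ZD[OF t, unfolded Z_def]
    show "((\<lambda>t. W (Z t)) has_vector_derivative of_real s * W' (Z t)) (at t)"
      unfolding Z_def by (rule has_vector_derivative_along_line[OF W[OF Zt]])
    have "((\<lambda>t. of_real s * W' (Z t)) has_vector_derivative
        of_real s * (of_real s * (\<rho> (Z t) * W' (Z t) - of_real (M\<^sup>2) * \<Phi> (Z t) * W (Z t)))) (at t)"
      unfolding Z_def
      by (rule has_vector_derivative_mult_right[OF has_vector_derivative_along_line[OF W'[OF Zt]]])
    also have "of_real s * (of_real s * (\<rho> (Z t) * W' (Z t) - of_real (M\<^sup>2) * \<Phi> (Z t) * W (Z t)))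
        = of_real s * \<rho> (Z t) * (of_real s * W' (Z t)) - of_real (M\<^sup>2) * \<Phi> (Z t) * W (Z t)"
      using s(1) by (simp add: algebra_simps flip: of_real_mult)
    finally show "((\<lambda>t. of_real s * W' (Z t)) has_vector_derivative
        of_real s * \<rho> (Z t) * (of_real s * W' (Z t)) - of_real (M\<^sup>2) * \<Phi> (Z t) * W (Z t)) (at t)" .
  qed (use \<Phi> \<rho> ZD s in \<open>auto simp: L_def norm_mult\<close>)
  moreover have "Z L = Complex x1 y" "Z 0 = Complex x0 y"
    by (auto simp: Z_def L_def s_def complex_eq_iff)
  ultimately show ?thesis using s by (simp add: energy_def norm_mult L_def)
qed

text \<open>A vertical direction \<open>u\<close> has \<open>u * u = - 1\<close>, which turns
  oscillation into exponential growth. By \<open>init\<close> the sum of squares has nonnegative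
  derivative when leaving the real axis at \<open>X\<close> in that direction.\<close>

lemma vertical_growth:
  fixes W1 W1' W2 W2' \<rho> \<Phi> :: "complex \<Rightarrow> complex" and s :: real
  assumes M: "M > 0"
    and W1: "\<And>Z. Z \<in> D \<Longrightarrow> (W1 has_field_derivative W1' Z) (at Z)"
    and W1': "\<And>Z. Z \<in> D \<Longrightarrow>
      (W1' has_field_derivative (\<rho> Z * W1' Z - of_real (M\<^sup>2) * \<Phi> Z * W1 Z)) (at Z)"
    and W2: "\<And>Z. Z \<in> D \<Longrightarrow> (W2 has_field_derivative W2' Z) (at Z)"
    and W2': "\<And>Z. Z \<in> D \<Longrightarrow>
      (W2' has_field_derivative (\<rho> Z * W2' Z - of_real (M\<^sup>2) * \<Phi> Z * W2 Z)) (at Z)"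
    and \<Phi>: "\<And>Z. Z \<in> D \<Longrightarrow> norm (\<Phi> Z - 1) \<le> e"
    and \<rho>: "\<And>Z. Z \<in> D \<Longrightarrow> norm (\<rho> Z) \<le> r"
    and k: "e + r / M \<le> 1 / 3"
    and s: "\<bar>s\<bar> = 1"
    and D: "\<And>y. 0 \<le> y \<Longrightarrow> y \<le> Y \<Longrightarrow> Complex X (s * y) \<in> D"
    and init: "s * (W1 (of_real X) \<bullet> (\<i> * W1' (of_real X)) + W2 (of_real X) \<bullet> (\<i> * W2' (of_real X))) \<ge> 0"
    and h: "0 \<le> h" "h + 2 * \<delta> \<le> Y" and \<delta>: "\<delta> > 0"
  shows "(norm (W1 (Complex X (s * Y))))\<^sup>2 + (norm (W2 (Complex X (s * Y))))\<^sup>2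
    \<ge> \<delta>\<^sup>2 / 4 * M\<^sup>2 * exp (M * \<delta>)
      * (energy M (W1 (Complex X (s * h))) (W1' (Complex X (s * h)))
        + energy M (W2 (Complex X (s * h))) (W2' (Complex X (s * h))))"
proof -
  define u where "u = of_real s * \<i>"
  have uu: "u * u = - 1" "norm u = 1"
    using s by (auto simp: u_def norm_mult abs_if split: if_splits)
  define Z where "Z t = of_real X + of_real t * u" for t
  have Z: "Z t = Complex X (s * t)" for t
    by (simp add: Z_def u_def complex_eq_iff)
  have ZD: "Z t \<in> D" if "0 \<le> t" "t \<le> Y" for t
    using D[OF that] by (simp add: Z)
  have 1: "((\<lambda>t. F (Z t)) has_vector_derivative u * F' (Z t)) (at t)"
    if "\<And>Z. Z \<in> D \<Longrightarrow> (F has_field_derivative F' Z) (at Z)" "0 \<le> t" "t \<le> Y" for F F' t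
    unfolding Z_def
    by (rule has_vector_derivative_along_line) (use that(1)[OF ZD[OF that(2,3)]] in \<open>simp add: Z_def\<close>)
  have 2: "((\<lambda>t. u * F' (Z t)) has_vector_derivative
      u * \<rho> (Z t) * (u * F' (Z t)) + of_real (M\<^sup>2) * \<Phi> (Z t) * F (Z t)) (at t)"
    if "\<And>Z. Z \<in> D \<Longrightarrow> (F' has_field_derivative (\<rho> Z * F' Z - of_real (M\<^sup>2) * \<Phi> Z * F Z)) (at Z)"
      "0 \<le> t" "t \<le> Y" for F F' t
  proof -
    have "((\<lambda>t. u * F' (Z t)) has_vector_derivative
        u * (u * (\<rho> (Z t) * F' (Z t) - of_real (M\<^sup>2) * \<Phi> (Z t) * F (Z t)))) (at t)"
      by (rule has_vector_derivative_mult_right[OF 1[OF that]])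
    also have "u * (u * (\<rho> (Z t) * F' (Z t) - of_real (M\<^sup>2) * \<Phi> (Z t) * F (Z t)))
        = u * \<rho> (Z t) * (u * F' (Z t)) - (u * u) * (of_real (M\<^sup>2) * \<Phi> (Z t) * F (Z t))"
      by (simp add: algebra_simps)
    finally show ?thesis by (simp add: uu)
  qed
  have "\<delta>\<^sup>2 / 4 * M\<^sup>2 * exp (M * \<delta>)
      * (energy M (W1 (Z h)) (u * W1' (Z h)) + energy M (W2 (Z h)) (u * W2' (Z h)))
      \<le> (norm (W1 (Z Y)))\<^sup>2 + (norm (W2 (Z Y)))\<^sup>2"
  proof (rule exponential_growth[OF M, where \<phi> = "\<lambda>t. \<Phi> (Z t)" and \<rho> = "\<lambda>t. u * \<rho> (Z t)"])
    show "0 \<le> W1 (Z 0) \<bullet> (u * W1' (Z 0)) + W2 (Z 0) \<bullet> (u * W2' (Z 0))"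
      using init by (simp add: Z_def u_def mult.assoc distrib_left flip: scaleR_conv_of_real)
  qed (use 1[OF W1] 1[OF W2] 2[OF W1'] 2[OF W2'] \<Phi> \<rho> ZD k h \<delta> uu in \<open>auto simp: norm_mult\<close>)
  then show ?thesis using uu by (simp add: Z energy_def norm_mult)
qed

text \<open>Both points are compared with the energy at \<open>Complex X (s * h)\<close>: rising
  from there to height \<open>Y\<close> gains \<open>exp (M * \<delta>)\<close>, while moving
  sideways to \<open>x\<close> loses at most \<open>exp (2 * (e * M + 2 * r))\<close>, the leading
  \<open>2\<close> being the horizontal distance.\<close>

lemma chord_midpoint_comparison:
  fixes W1 W1' W2 W2' \<rho> \<Phi> :: "complex \<Rightarrow> complex" and s :: real
  assumes M: "M > 0"
    and W1: "\<And>Z. Z \<in> D \<Longrightarrow> (W1 has_field_derivative W1' Z) (at Z)"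
    and W1': "\<And>Z. Z \<in> D \<Longrightarrow>
      (W1' has_field_derivative (\<rho> Z * W1' Z - of_real (M\<^sup>2) * \<Phi> Z * W1 Z)) (at Z)"
    and W2: "\<And>Z. Z \<in> D \<Longrightarrow> (W2 has_field_derivative W2' Z) (at Z)"
    and W2': "\<And>Z. Z \<in> D \<Longrightarrow>
      (W2' has_field_derivative (\<rho> Z * W2' Z - of_real (M\<^sup>2) * \<Phi> Z * W2 Z)) (at Z)"
    and \<Phi>: "\<And>Z. Z \<in> D \<Longrightarrow> norm (\<Phi> Z - 1) \<le> e"
    and \<rho>: "\<And>Z. Z \<in> D \<Longrightarrow> norm (\<rho> Z) \<le> r"
    and k: "e + r / M \<le> 1 / 3"
    and s: "\<bar>s\<bar> = 1"
    and D: "\<And>y. 0 \<le> y \<Longrightarrow> y \<le> Y \<Longrightarrow> Complex X (s * y) \<in> D"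
    and init: "s * (W1 (of_real X) \<bullet> (\<i> * W1' (of_real X)) + W2 (of_real X) \<bullet> (\<i> * W2' (of_real X))) \<ge> 0"
    and h: "0 \<le> h" "h + 2 * \<delta> \<le> Y" and \<delta>: "\<delta> > 0"
    and Dq: "\<And>t. t \<in> closed_segment X x \<Longrightarrow> Complex t (s * h) \<in> D"
    and x: "\<bar>x - X\<bar> \<le> 2"
  shows "\<delta>\<^sup>2 / 4 * M\<^sup>2 * exp (M * \<delta> - 2 * (e * M + 2 * r))
      * ((norm (W1 (Complex x (s * h))))\<^sup>2 + (norm (W2 (Complex x (s * h))))\<^sup>2)
    \<le> (norm (W1 (Complex X (s * Y))))\<^sup>2 + (norm (W2 (Complex X (s * Y))))\<^sup>2"
proof -
  let ?q = "Complex x (s * h)" and ?p = "Complex X (s * h)"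
  define k where "k = exp (2 * (e * M + 2 * r))"
  have pD: "?p \<in> D" using Dq[of X] by simp
  have er: "0 \<le> e" "0 \<le> r"
    using \<Phi>[OF pD] \<rho>[OF pD] norm_ge_zero order_trans by blast+
  have "exp ((e * M + 2 * r) * \<bar>x - X\<bar>) \<le> k"
    unfolding k_def using er M mult_left_mono[OF x, of "e * M + 2 * r"] by simp
  then have le: "(norm (F ?q))\<^sup>2 \<le> energy M (F ?p) (F' ?p) * k"
    if "\<And>Z. Z \<in> D \<Longrightarrow> (F has_field_derivative F' Z) (at Z)"
      "\<And>Z. Z \<in> D \<Longrightarrow> (F' has_field_derivative (\<rho> Z * F' Z - of_real (M\<^sup>2) * \<Phi> Z * F Z)) (at Z)" for F F'
  proof -
    have "(norm (F ?q))\<^sup>2 \<le> energy M (F ?q) (F' ?q)" by (simp add: energy_def)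
    also have "\<dots> \<le> energy M (F ?p) (F' ?p) * exp ((e * M + 2 * r) * \<bar>x - X\<bar>)"
      by (rule horizontal_energy_le[OF M that(1,2) \<Phi> \<rho> Dq])
    also have "\<dots> \<le> energy M (F ?p) (F' ?p) * k"
      by (intro mult_left_mono) (fact, simp add: energy_def)
    finally show ?thesis .
  qed
  define A where "A = \<delta>\<^sup>2 / 4 * M\<^sup>2 * exp (M * \<delta>)"
  define E where "E = energy M (W1 ?p) (W1' ?p) + energy M (W2 ?p) (W2' ?p)"
  have "A / k * ((norm (W1 ?q))\<^sup>2 + (norm (W2 ?q))\<^sup>2) \<le> A / k * (E * k)"
    using le[OF W1 W1'] le[OF W2 W2'] unfolding E_def
    by (intro mult_left_mono) (auto simp: A_def k_def algebra_simps)
  also have "\<dots> = A * E" by (simp add: k_def)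
  also have "\<dots> \<le> (norm (W1 (Complex X (s * Y))))\<^sup>2 + (norm (W2 (Complex X (s * Y))))\<^sup>2"
    unfolding A_def E_def
    by (rule vertical_growth[OF M W1 W1' W2 W2' \<Phi> \<rho> \<open>e + r / M \<le> 1 / 3\<close> s D init h \<delta>])
  also have "A / k = \<delta>\<^sup>2 / 4 * M\<^sup>2 * exp (M * \<delta> - 2 * (e * M + 2 * r))"
    by (simp add: A_def k_def exp_diff)
  finally show ?thesis .
qed

text \<open>The chord joins \<open>1\<close> to \<open>exp (2 \<i> \<psi>)\<close> with \<open>\<psi>\<close> slightly below
  \<open>\<pi> / 2\<close>; in the coordinate \<open>Z\<^sup>\<kappa>\<close> its midpoint has argument \<open>\<kappa> \<psi>\<close> and
  modulus \<open>cos (\<kappa> \<psi>)\<close>.\<close>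

lemma chord_points:
  obtains d \<delta> :: real where "0 < d" "d \<le> 1" "0 < \<delta>"
    "\<And>\<kappa>. 0 < \<kappa> \<Longrightarrow> \<kappa> \<le> 4 / 5 \<Longrightarrow> \<exists>X Y x h. d \<le> X \<and> X \<le> 1 \<and> Y \<le> 1 \<and> d \<le> h \<and> h + 2 * \<delta> \<le> Y
      \<and> \<bar>x\<bar> \<le> 1 \<and> (\<forall>s. \<bar>s\<bar> = 1 \<longrightarrow>
        1 + exp (of_real \<kappa> * Ln (Complex x (s * h))) = 2 * exp (of_real \<kappa> * Ln (Complex X (s * Y))))"
proof -
  \<comment> \<open>A bound for \<open>\<kappa> * \<psi>\<close>, as
    \<open>\<kappa> \<le> 4 / 5\<close> and \<open>\<psi> < pi / 2\<close>. \<open>C\<close> will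
    bound \<open>- ln (cos (\<kappa> * \<psi>)) / \<kappa>\<close> uniformly, even for small
    \<open>\<kappa>\<close>, so that \<open>d\<close> and \<open>\<delta>\<close> do not depend on
    \<open>\<kappa>\<close>.\<close>
  define y1 :: real where "y1 = 2 * pi / 5"
  have y1: "0 < y1" "y1 < pi / 2" using pi_gt_zero by (auto simp: y1_def)
  define C where "C = pi / 2 * tan y1"
  have C: "C > 0" using y1 pi_gt_zero by (simp add: C_def tan_gt_zero)
  define b where "b = exp (- C) / 4"
  have b: "0 < b" "b \<le> 1 / 4" using C by (auto simp: b_def)
  define \<psi> where "\<psi> = arccos b"
  have \<psi>: "0 < \<psi>" "\<psi> < pi / 2"
    using b arccos_less_arccos[of b 1] arccos_less_arccos[of 0 b] by (auto simp: \<psi>_def)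
  have cos\<psi>: "cos \<psi> = b" using b by (simp add: \<psi>_def)
  have sin\<psi>0: "0 \<le> sin \<psi>" "sin \<psi> \<le> 1" using \<psi> sin_gt_zero[of \<psi>] pi_gt_zero by auto
  have "b\<^sup>2 \<le> (1 / 4)\<^sup>2" using b by (intro power_mono) auto
  moreover have "(sin \<psi>)\<^sup>2 = 1 - b\<^sup>2" by (simp add: sin_squared_eq cos\<psi>)
  ultimately have "15 / 16 \<le> (sin \<psi>)\<^sup>2" by (simp add: power2_eq_square[of "1 / 4 :: real"])
  also have "(sin \<psi>)\<^sup>2 \<le> sin \<psi>" using sin\<psi>0 by (simp add: power2_eq_square mult_left_le)
  finally have sin\<psi>: "15 / 16 \<le> sin \<psi>" .
  show thesis
  proof (rule that[of "4 * b\<^sup>2" "b / 2"])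
    show "0 < 4 * b\<^sup>2" "0 < b / 2" using b by auto
    show "4 * b\<^sup>2 \<le> 1" using \<open>b\<^sup>2 \<le> (1 / 4)\<^sup>2\<close> by (simp add: power2_eq_square)
    fix \<kappa> :: real assume \<kappa>: "0 < \<kappa>" "\<kappa> \<le> 4 / 5"
    define y where "y = \<kappa> * \<psi>"
    have y: "0 < y" "y \<le> y1" "y \<le> \<kappa> * (pi / 2)"
    proof -
      show "0 < y" using \<kappa> \<psi> by (simp add: y_def)
      show "y \<le> \<kappa> * (pi / 2)" unfolding y_def using \<kappa> \<psi> by (intro mult_left_mono) auto
      have "\<kappa> * \<psi> \<le> 4 / 5 * (pi / 2)" using \<kappa> \<psi> by (intro mult_mono) auto
      then show "y \<le> y1" by (simp add: y_def y1_def)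
    qed
    have cosy: "0 < cos t" if "0 \<le> t" "t \<le> y" for t
      using that y y1 by (intro cos_gt_zero_pi) auto
    \<comment> \<open>The derivative \<open>- tan t\<close> of \<open>ln (cos t)\<close> is at least
      \<open>- tan y1\<close> here, so \<open>- ln (cos y)\<close> is at most linear in
      \<open>y\<close>, hence in \<open>\<kappa>\<close>.\<close>
    have "ln (cos 0) + tan y1 * 0 \<le> ln (cos y) + tan y1 * y"
    proof (rule DERIV_nonneg_imp_nondecreasing[where f = "\<lambda>t. ln (cos t) + tan y1 * t"])
      fix t assume t: "0 \<le> t" "t \<le> y"
      have tan_t: "tan t = sin t / cos t" by (simp add: tan_def)
      have "((\<lambda>t. ln (cos t) + tan y1 * t) has_real_derivative tan y1 - tan t) (at t)"
        using cosy[OF t] by (auto intro!: derivative_eq_intros simp: tan_t)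
      moreover have "tan t \<le> tan y1" using t y y1 by (cases "t = y1") (auto intro!: tan_monotone less_imp_le)
      ultimately show "\<exists>l. ((\<lambda>t. ln (cos t) + tan y1 * t) has_real_derivative l) (at t) \<and> 0 \<le> l"
        by (intro exI[of _ "tan y1 - tan t"]) auto
    qed (use y in simp)
    then have "ln (cos y) \<ge> - (tan y1 * y)" by simp
    moreover have "tan y1 * y \<le> tan y1 * (\<kappa> * (pi / 2))"
      using y y1 by (intro mult_left_mono) (auto intro!: less_imp_le[OF tan_gt_zero])
    ultimately have lncos: "ln (cos y) / \<kappa> \<ge> - C"
      using \<kappa> by (simp add: C_def field_simps)
    \<comment> \<open>The modulus of the midpoint in the \<open>Z\<close>-plane: its power with
      exponent \<open>\<kappa>\<close> is \<open>cos y\<close>.\<close>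
    define c where "c = exp (ln (cos y) / \<kappa>)"
    have c4: "4 * b \<le> c" using lncos by (simp add: b_def c_def)
    have c1: "c \<le> 1" using cosy[of y] y \<kappa> by (simp add: c_def divide_nonpos_pos)
    have Ln_eq: "Ln (exp (Complex u v)) = Complex u v" if "\<bar>v\<bar> < pi" for u v
      using that by (intro Ln_exp) auto
    show "\<exists>X Y x h. 4 * b\<^sup>2 \<le> X \<and> X \<le> 1 \<and> Y \<le> 1 \<and> 4 * b\<^sup>2 \<le> h \<and> h + 2 * (b / 2) \<le> Y
      \<and> \<bar>x\<bar> \<le> 1 \<and> (\<forall>s. \<bar>s\<bar> = 1 \<longrightarrow>
        1 + exp (of_real \<kappa> * Ln (Complex x (s * h))) = 2 * exp (of_real \<kappa> * Ln (Complex X (s * Y))))"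
    proof (intro exI conjI allI impI)
      \<comment> \<open>\<open>Complex X Y\<close> is \<open>c * cis \<psi>\<close>, the midpoint,
        and \<open>Complex x h\<close> is \<open>cis (2 * \<psi>)\<close>, the end point other than
        \<open>1\<close>. The gap \<open>Y - h = (c - 2 * b) * sin \<psi>\<close> is at least
        \<open>b\<close> because \<open>c \<ge> 4 * b\<close>.\<close>
      show "4 * b\<^sup>2 \<le> c * cos \<psi>" using c4 b by (simp add: cos\<psi> power2_eq_square)
      show "c * cos \<psi> \<le> 1" using c1 c4 b by (simp add: cos\<psi> mult_le_one)
      show "c * sin \<psi> \<le> 1" using c1 c4 b sin\<psi>0 by (simp add: mult_le_one)
      have "2 * b * (15 / 16) \<le> 2 * b * sin \<psi>" using b sin\<psi> by (intro mult_left_mono) auto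
      moreover have "4 * b * b \<le> 1 * b" using b by (intro mult_right_mono) auto
      ultimately show "4 * b\<^sup>2 \<le> sin (2 * \<psi>)"
        using b by (simp add: sin_double cos\<psi> power2_eq_square)
      have "2 * b * (15 / 16) \<le> (c - 2 * b) * sin \<psi>"
        using b c4 sin\<psi> by (intro mult_mono) auto
      moreover have "sin (2 * \<psi>) = 2 * b * sin \<psi>" by (simp add: sin_double cos\<psi>)
      ultimately show "sin (2 * \<psi>) + 2 * (b / 2) \<le> c * sin \<psi>"
        using b by (simp only: left_diff_distrib)
      show "\<bar>cos (2 * \<psi>)\<bar> \<le> 1" by simp
      fix s :: real assume "\<bar>s\<bar> = 1"
      then have s: "s = 1 \<or> s = -1" by linarith
      have b': "Complex (cos (2 * \<psi>)) (s * sin (2 * \<psi>)) = exp (Complex 0 (s * (2 * \<psi>)))"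
        using s by (auto simp: exp_eq_polar complex_eq_iff cis.sel)
      have m': "Complex (c * cos \<psi>) (s * (c * sin \<psi>)) = exp (Complex (ln (cos y) / \<kappa>) (s * \<psi>))"
        using s by (auto simp: exp_eq_polar complex_eq_iff cis.sel c_def)
      have Lb: "Ln (Complex (cos (2 * \<psi>)) (s * sin (2 * \<psi>))) = Complex 0 (s * (2 * \<psi>))"
        unfolding b' by (rule Ln_eq) (use s \<psi> in auto)
      have Lm: "Ln (Complex (c * cos \<psi>) (s * (c * sin \<psi>))) = Complex (ln (cos y) / \<kappa>) (s * \<psi>)"
        unfolding m' by (rule Ln_eq) (use s \<psi> in auto)
      have eb: "exp (of_real \<kappa> * Complex 0 (s * (2 * \<psi>))) = cis (2 * (s * y))"
        by (simp add: exp_eq_polar y_def mult_ac)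
      have em: "exp (of_real \<kappa> * Complex (ln (cos y) / \<kappa>) (s * \<psi>)) = of_real (cos y) * cis (s * y)"
        using \<kappa> cosy[of y] y by (simp add: exp_eq_polar y_def mult_ac flip: exp_of_real)
      have "1 + cis (2 * (s * y)) = 2 * (of_real (cos (s * y)) * cis (s * y))"
        by (simp add: complex_eq_iff cos_double_cos sin_double power2_eq_square)
      also have "cos (s * y) = cos y" using s by auto
      finally show "1 + exp (of_real \<kappa> * Ln (Complex (cos (2 * \<psi>)) (s * sin (2 * \<psi>))))
          = 2 * exp (of_real \<kappa> * Ln (Complex (c * cos \<psi>) (s * (c * sin \<psi>))))"
        unfolding Lb Lm eb em .
    qed
  qed
qed

text \<open>The rotated power map \<open>zm\<close> turns both equations into almost harmonic
  oscillators of large frequency \<open>M\<close> on \<open>D\<close>. The chord from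
  \<open>a\<close> to \<open>b\<close> has midpoint \<open>zm (Complex X (s * Y))\<close>, farther
  from the real axis of the \<open>Z\<close>-plane than both ends.\<close>

lemma oscillation_midpoint_violation:
  fixes w1 w2 P :: "complex \<Rightarrow> complex"
  assumes w1: "w1 holomorphic_on UNIV" and w2: "w2 holomorphic_on UNIV" and P: "P holomorphic_on UNIV"
    and ode1: "\<And>z. deriv (deriv w1) z = - P z * w1 z"
    and ode2: "\<And>z. deriv (deriv w2) z = - P z * w2 z"
    and nc: "\<not> P constant_on UNIV"
    and pos: "\<And>z. (norm (w1 z))\<^sup>2 + (norm (w2 z))\<^sup>2 > 0"
    and K: "K > 0"
  shows "\<exists>a b. K * max ((norm (w1 a))\<^sup>2 + (norm (w2 a))\<^sup>2) ((norm (w1 b))\<^sup>2 + (norm (w2 b))\<^sup>2)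
    < (norm (w1 ((a + b) / 2)))\<^sup>2 + (norm (w2 ((a + b) / 2)))\<^sup>2"
proof -
  obtain d \<delta> :: real where d: "0 < d" "d \<le> 1" and \<delta>: "0 < \<delta>"
    and chord: "\<And>\<kappa>. 0 < \<kappa> \<Longrightarrow> \<kappa> \<le> 4 / 5 \<Longrightarrow> \<exists>X Y x h. d \<le> X \<and> X \<le> 1 \<and> Y \<le> 1 \<and> d \<le> h \<and> h + 2 * \<delta> \<le> Y
      \<and> \<bar>x\<bar> \<le> 1 \<and> (\<forall>s. \<bar>s\<bar> = 1 \<longrightarrow>
        1 + exp (of_real \<kappa> * Ln (Complex x (s * h))) = 2 * exp (of_real \<kappa> * Ln (Complex X (s * Y))))"
    using chord_points by blast
  define \<Omega> where "\<Omega> = ln 2 - ln d + pi"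
  \<comment> \<open>\<open>e \<le> \<delta> / 8\<close> keeps the horizontal loss
    \<open>2 * e * M\<close> below the gain \<open>M * \<delta>\<close>;
    \<open>e \<le> 1 / 6\<close> leaves half of the budget \<open>1 / 3\<close> to the first-order
    term.\<close>
  define e where "e = min (\<delta> / 8) (1 / 6)"
  have e: "0 < e" "e \<le> \<delta> / 8" "e \<le> 1 / 6" using \<delta> by (auto simp: e_def)
  have "ln d \<le> 0" using d by simp
  then have \<Omega>: "0 < \<Omega>" unfolding \<Omega>_def using pi_gt_zero ln_gt_zero[of "2::real"] by linarith
  \<comment> \<open>The first summand forces \<open>M \<ge> 6 / d\<close>, the second makes the gain
    exceed \<open>K\<close> in \<open>big\<close>.\<close>
  define S where "S = (6 / d)\<^sup>2 + 4 * K * exp (4 / d) / \<delta>\<^sup>2"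
  have R0: "0 < 2 * \<Omega> + pi" using \<Omega> pi_gt_zero by linarith
  \<comment> \<open>The factor \<open>25 / 4\<close> compensates for
    \<open>\<kappa> \<ge> 2 / (5 * N)\<close>, so that \<open>M\<^sup>2 \<ge> S + 1\<close>. The
    radius \<open>2 * \<Omega> + pi\<close> bounds \<open>\<tau>\<close> on
    \<open>D\<close>.\<close>
  obtain z0 N where N: "N \<ge> 1 / 2" and z0: "z0 \<noteq> 0" and P0: "P z0 \<noteq> 0"
    and T: "25 / 4 * (S + 1) \<le> norm (P z0) * (norm z0)\<^sup>2 / N\<^sup>2"
    and near: "\<And>t. norm t \<le> 2 * \<Omega> + pi \<Longrightarrow>
      norm (P (z0 * exp (t / of_real N)) * exp (- t) / P z0 - 1) \<le> e"
    using power_like_point[OF P nc R0 e(1), where T = "25 / 4 * (S + 1)"] by metis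
  \<comment> \<open>For \<open>z\<close> proportional to the power \<open>\<kappa>\<close> of
    \<open>Z\<close>, the power \<open>N\<close> of \<open>z\<close> times the square of
    \<open>dz / dZ\<close> is then constant:
    \<open>\<kappa> * N + 2 * (\<kappa> - 1) = 0\<close>.\<close>
  define \<kappa> where "\<kappa> = 2 / (N + 2)"
  have \<kappa>: "0 < \<kappa>" "\<kappa> \<le> 4 / 5" "\<kappa> * (N + 2) = 2" "2 / (5 * N) \<le> \<kappa>"
    using N by (auto simp: \<kappa>_def field_simps)
  obtain X Y x h where XY: "d \<le> X" "X \<le> 1" "Y \<le> 1" "d \<le> h" "h + 2 * \<delta> \<le> Y" "\<bar>x\<bar> \<le> 1"
    and mid: "\<And>s. \<bar>s\<bar> = 1 \<Longrightarrow>
        1 + exp (of_real \<kappa> * Ln (Complex x (s * h))) = 2 * exp (of_real \<kappa> * Ln (Complex X (s * Y)))"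
    using chord[OF \<kappa>(1,2)] by blast
  define M where "M = sqrt (norm (P z0)) * norm z0 * \<kappa>"
  have M: "M > 0" using z0 P0 \<kappa> by (simp add: M_def)
  have M2: "M\<^sup>2 = norm (P z0) * (norm z0)\<^sup>2 * \<kappa>\<^sup>2"
    by (simp add: M_def power_mult_distrib)
  have "S + 1 \<le> M\<^sup>2"
  proof -
    have "25 / 4 * (S + 1) * (2 / 5)\<^sup>2 \<le> norm (P z0) * (norm z0)\<^sup>2 / N\<^sup>2 * (2 / 5)\<^sup>2"
      by (intro mult_right_mono T) auto
    also have "\<dots> = norm (P z0) * (norm z0)\<^sup>2 * (2 / (5 * N))\<^sup>2"
      by (simp add: power_mult_distrib power_divide)
    also have "\<dots> \<le> M\<^sup>2"
      unfolding M2 using \<kappa>(4) N by (intro mult_left_mono power_mono) auto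
    finally show ?thesis by (simp add: power2_eq_square)
  qed
  moreover have "0 \<le> 4 * K * exp (4 / d) / \<delta>\<^sup>2" using K by simp
  ultimately have M6: "(6 / d)\<^sup>2 \<le> M\<^sup>2" and MK: "4 * K * exp (4 / d) / \<delta>\<^sup>2 < M\<^sup>2"
    unfolding S_def using zero_le_power2[of "6 / d"] by linarith+
  have "6 / d \<le> M" using power2_le_imp_le[OF M6] M by simp
  then have "1 / d / M \<le> 1 / 6" using d M by (simp add: field_simps)
  then have k: "e + 1 / d / M \<le> 1 / 3" using e(3) by linarith
  \<comment> \<open>The rotation contributes the phase \<open>(N + 2) * \<theta>\<close> to the
    potential and so cancels the argument of \<open>P z0 * z0\<^sup>2\<close>.\<close>
  define \<theta> where "\<theta> = - Arg (P z0 * z0\<^sup>2) / (N + 2)"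
  define zm where "zm Z = z0 * exp (\<i> * of_real \<theta>) * exp (of_real \<kappa> * Ln Z)" for Z
  define \<tau> where "\<tau> Z = of_real N * (of_real \<kappa> * Ln Z + \<i> * of_real \<theta>)" for Z
  define \<Phi> where "\<Phi> Z = P (z0 * exp (\<tau> Z / of_real N)) * exp (- \<tau> Z) / P z0" for Z
  \<comment> \<open>The first-order coefficient \<open>zm'' / zm'\<close> created by the change of
    variable.\<close>
  define \<rho> where "\<rho> Z = of_real (\<kappa> - 1) / Z" for Z :: complex
  \<comment> \<open>A slit annulus, inside the domain of the principal \<open>Ln\<close>; on it
    \<open>norm (Ln Z) \<le> \<Omega>\<close>.\<close>
  define D :: "complex set" where "D = {Z. Z \<notin> \<real>\<^sub>\<le>\<^sub>0 \<and> d \<le> norm Z \<and> norm Z \<le> 2}"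
  have \<rho>: "norm (\<rho> Z) \<le> 1 / d" if "Z \<in> D" for Z
  proof -
    have "norm (\<rho> Z) = (1 - \<kappa>) / norm Z"
      unfolding \<rho>_def norm_divide norm_of_real using \<kappa> by simp
    also have "\<dots> \<le> 1 / d" using \<kappa> d that by (intro frac_le) (auto simp: D_def)
    finally show ?thesis .
  qed
  have zm: "zm Z = z0 * exp (\<tau> Z / of_real N)" for Z
    using N by (simp add: zm_def \<tau>_def exp_add mult_ac)
  have \<Phi>: "norm (\<Phi> Z - 1) \<le> e" if "Z \<in> D" for Z
  proof -
    have Z: "Z \<noteq> 0" "d \<le> norm Z" "norm Z \<le> 2" using that d by (auto simp: D_def)
    have "norm (Ln Z) \<le> \<bar>ln (norm Z)\<bar> + \<bar>Im (Ln Z)\<bar>"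
      using cmod_le[of "Ln Z"] Z by simp
    also have "\<bar>Im (Ln Z)\<bar> \<le> pi" using mpi_less_Im_Ln[OF Z(1)] Im_Ln_le_pi[OF Z(1)] by simp
    also have "\<bar>ln (norm Z)\<bar> \<le> ln 2 - ln d"
    proof -
      have "ln d \<le> ln (norm Z)" "ln (norm Z) \<le> ln 2" using Z d by (auto intro!: ln_mono)
      moreover have "ln d \<le> 0" "0 \<le> ln (2::real)" using d by auto
      ultimately show ?thesis by linarith
    qed
    finally have Ln: "norm (Ln Z) \<le> \<Omega>" by (simp add: \<Omega>_def)
    have "norm (\<tau> Z) = N * norm (of_real \<kappa> * Ln Z + \<i> * of_real \<theta>)"
      using N by (simp add: \<tau>_def norm_mult)
    also have "\<dots> \<le> N * (\<kappa> * norm (Ln Z) + \<bar>\<theta>\<bar>)"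
      using N \<kappa> by (intro mult_left_mono norm_triangle_le) (auto simp: norm_mult)
    also have "\<dots> = (N * \<kappa>) * norm (Ln Z) + N * \<bar>\<theta>\<bar>"
      by (simp add: algebra_simps)
    also have "\<dots> \<le> 2 * \<Omega> + pi"
    proof (intro add_mono mult_mono Ln)
      show "N * \<kappa> \<le> 2" using \<kappa> by (simp add: algebra_simps)
      have "N * \<bar>\<theta>\<bar> = (N / (N + 2)) * \<bar>Arg (P z0 * z0\<^sup>2)\<bar>" using N by (simp add: \<theta>_def abs_divide)
      also have "\<dots> \<le> 1 * pi"
        using N Arg_bounded[of "P z0 * z0\<^sup>2"] by (intro mult_mono) (auto simp: abs_le_iff)
      finally show "N * \<bar>\<theta>\<bar> \<le> pi" by simp
    qed (use \<Omega> N \<kappa> in auto)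
    finally show ?thesis unfolding \<Phi>_def by (rule near)
  qed
  \<comment> \<open>The coefficient of \<open>w (zm Z)\<close> after the change of variable: the
    powers of \<open>Z\<close> cancel by the choice of \<open>\<kappa>\<close>, the phase by that of
    \<open>\<theta>\<close>.\<close>
  have potential: "P (zm Z) * (zm Z * of_real \<kappa> / Z)\<^sup>2 = of_real (M\<^sup>2) * \<Phi> Z" if "Z \<in> D" for Z
  proof -
    have Z: "Z \<noteq> 0" using that by (auto simp: D_def)
    have "(zm Z)\<^sup>2 = z0\<^sup>2 * exp (2 * (\<i> * of_real \<theta>) + 2 * (of_real \<kappa> * Ln Z))"
      by (simp add: zm_def power_mult_distrib exp_add exp_double)
    moreover have "Z\<^sup>2 = exp (2 * Ln Z)" using Z by (simp add: exp_double)
    moreover have "P (zm Z) = P z0 * \<Phi> Z * exp (\<tau> Z)"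
      using P0 by (simp add: \<Phi>_def zm exp_minus)
    ultimately have "P (zm Z) * (zm Z * of_real \<kappa> / Z)\<^sup>2
        = P z0 * z0\<^sup>2 * of_real (\<kappa>\<^sup>2) * \<Phi> Z * (exp (\<tau> Z) * exp (2 * (\<i> * of_real \<theta>) + 2 * (of_real \<kappa> * Ln Z)) / exp (2 * Ln Z))"
      by (simp add: power_mult_distrib power_divide)
    also have "exp (\<tau> Z) * exp (2 * (\<i> * of_real \<theta>) + 2 * (of_real \<kappa> * Ln Z)) / exp (2 * Ln Z)
        = exp (\<i> * of_real ((N + 2) * \<theta>))"
    proof -
      have "\<tau> Z + (2 * (\<i> * of_real \<theta>) + 2 * (of_real \<kappa> * Ln Z)) - 2 * Ln Z
          = \<i> * of_real ((N + 2) * \<theta>) + (of_real (\<kappa> * (N + 2)) - 2) * Ln Z"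
        by (simp add: \<tau>_def algebra_simps)
      also have "\<dots> = \<i> * of_real ((N + 2) * \<theta>)" unfolding \<kappa>(3) by simp
      finally show ?thesis by (simp flip: exp_add exp_diff)
    qed
    also have "(N + 2) * \<theta> = - Arg (P z0 * z0\<^sup>2)" using N by (simp add: \<theta>_def)
    also have "P z0 * z0\<^sup>2 * of_real (\<kappa>\<^sup>2) * \<Phi> Z * exp (\<i> * of_real (- Arg (P z0 * z0\<^sup>2)))
        = (P z0 * z0\<^sup>2 * exp (\<i> * of_real (- Arg (P z0 * z0\<^sup>2)))) * of_real (\<kappa>\<^sup>2) * \<Phi> Z"
      by (simp add: mult_ac)
    also have "P z0 * z0\<^sup>2 * exp (\<i> * of_real (- Arg (P z0 * z0\<^sup>2))) = of_real (norm (P z0 * z0\<^sup>2))"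
      by (subst (1) Arg_eq[of "P z0 * z0\<^sup>2"]) (use z0 P0 in \<open>auto simp: mult.assoc simp flip: exp_add\<close>)
    finally show ?thesis by (simp add: M2 norm_mult norm_power)
  qed
  have Dzm: "(zm has_field_derivative zm Z * of_real \<kappa> / Z) (at Z)" if "Z \<in> D" for Z
    unfolding zm_def using that
    by (auto intro!: derivative_eq_intros simp: D_def divide_inverse)
  define W' where "W' w Z = deriv w (zm Z) * (zm Z * of_real \<kappa> / Z)" for w :: "complex \<Rightarrow> complex" and Z
  have DW: "((\<lambda>Z. w (zm Z)) has_field_derivative W' w Z) (at Z)"
    if w: "w holomorphic_on UNIV" and Z: "Z \<in> D" for w Z
    unfolding W'_def by (rule DERIV_chain2[OF holomorphic_derivI[OF w] Dzm[OF Z]]) auto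
  have DW': "(W' w has_field_derivative (\<rho> Z * W' w Z - of_real (M\<^sup>2) * \<Phi> Z * w (zm Z))) (at Z)"
    if w: "w holomorphic_on UNIV" and ode: "\<And>z. deriv (deriv w) z = - P z * w z" and Z: "Z \<in> D" for w Z
  proof -
    have Z0: "Z \<noteq> 0" using Z by (auto simp: D_def)
    have "((\<lambda>Z. deriv w (zm Z)) has_field_derivative deriv (deriv w) (zm Z) * (zm Z * of_real \<kappa> / Z)) (at Z)"
      by (rule DERIV_chain2[OF holomorphic_derivI[OF holomorphic_deriv[OF w]] Dzm[OF Z]]) auto
    moreover have "((\<lambda>Z. zm Z * of_real \<kappa> / Z) has_field_derivative
        zm Z * of_real \<kappa> / Z * (of_real (\<kappa> - 1) / Z)) (at Z)"
      by (rule derivative_eq_intros Dzm[OF Z] refl)+ (use Z0 in \<open>auto simp: field_simps\<close>)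
    ultimately have "(W' w has_field_derivative
        deriv (deriv w) (zm Z) * (zm Z * of_real \<kappa> / Z) * (zm Z * of_real \<kappa> / Z)
        + zm Z * of_real \<kappa> / Z * (of_real (\<kappa> - 1) / Z) * deriv w (zm Z)) (at Z)"
      unfolding W'_def by (rule DERIV_mult)
    also have "deriv (deriv w) (zm Z) * (zm Z * of_real \<kappa> / Z) * (zm Z * of_real \<kappa> / Z)
        + zm Z * of_real \<kappa> / Z * (of_real (\<kappa> - 1) / Z) * deriv w (zm Z)
        = \<rho> Z * W' w Z - (P (zm Z) * (zm Z * of_real \<kappa> / Z)\<^sup>2) * w (zm Z)"
      by (simp add: ode \<rho>_def W'_def power2_eq_square mult_ac)
    also have "\<dots> = \<rho> Z * W' w Z - of_real (M\<^sup>2) * \<Phi> Z * w (zm Z)"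
      by (simp only: potential[OF Z])
    finally show ?thesis .
  qed
  \<comment> \<open>Half the derivative, in the direction \<open>\<i>\<close> at \<open>X\<close>,
    of the sum of squares pulled back by \<open>zm\<close>; \<open>s\<close> selects a vertical
    direction in which it does not decrease.\<close>
  define I where "I = w1 (zm X) \<bullet> (\<i> * W' w1 X) + w2 (zm X) \<bullet> (\<i> * W' w2 X)"
  define s :: real where "s = (if I \<ge> 0 then 1 else - 1)"
  have s: "\<bar>s\<bar> = 1" and sI: "s * I \<ge> 0" by (auto simp: s_def)
  have right_in_D: "Complex a b \<in> D" if "d \<le> a" "a \<le> 1" "\<bar>b\<bar> \<le> 1" for a b
    using that d abs_Re_le_cmod[of "Complex a b"] cmod_le[of "Complex a b"]
    by (auto simp: D_def complex_nonpos_Reals_iff)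
  have upper_in_D: "Complex a b \<in> D" if "d \<le> \<bar>b\<bar>" "\<bar>a\<bar> \<le> 1" "\<bar>b\<bar> \<le> 1" for a b
    using that d abs_Im_le_cmod[of "Complex a b"] cmod_le[of "Complex a b"]
    by (auto simp: D_def complex_nonpos_Reals_iff)
  define v where "v z = (norm (w1 z))\<^sup>2 + (norm (w2 z))\<^sup>2" for z
  have compare: "\<delta>\<^sup>2 / 4 * M\<^sup>2 * exp (M * \<delta> - 2 * (e * M + 2 * (1 / d))) * v (zm (Complex t (s * y)))
      \<le> v (zm (Complex X (s * Y)))"
    if y: "0 \<le> y" "y + 2 * \<delta> \<le> Y" and t: "\<bar>t\<bar> \<le> 1"
      and seg: "\<And>t'. t' \<in> closed_segment X t \<Longrightarrow> Complex t' (s * y) \<in> D" for t y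
    unfolding v_def
  proof (rule chord_midpoint_comparison[where D = D and ?W1.0 = "\<lambda>Z. w1 (zm Z)" and ?W2.0 = "\<lambda>Z. w2 (zm Z)"
        and ?W1'.0 = "W' w1" and ?W2'.0 = "W' w2" and \<rho> = \<rho> and \<Phi> = \<Phi>,
        OF M DW[OF w1] DW'[OF w1 ode1] DW[OF w2] DW'[OF w2 ode2] \<Phi> \<rho> k s _ _ y \<delta> seg])
    show "Complex X (s * y') \<in> D" if "0 \<le> y'" "y' \<le> Y" for y'
      using that XY s by (intro right_in_D) (auto simp: abs_mult)
    show "0 \<le> s * (w1 (zm (of_real X)) \<bullet> (\<i> * W' w1 (of_real X)) + w2 (zm (of_real X)) \<bullet> (\<i> * W' w2 (of_real X)))"
      using sI by (simp add: I_def)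
    show "\<bar>t - X\<bar> \<le> 2" using t XY d by auto
  qed
  have big: "K * v q < v (zm (Complex X (s * Y)))"
    if "\<delta>\<^sup>2 / 4 * M\<^sup>2 * exp (M * \<delta> - 2 * (e * M + 2 * (1 / d))) * v q \<le> v (zm (Complex X (s * Y)))" for q
  proof -
    have "K = \<delta>\<^sup>2 / 4 * (4 * K * exp (4 / d) / \<delta>\<^sup>2) * exp (- (4 / d))"
      using \<delta> by (simp add: exp_minus)
    also have "\<dots> < \<delta>\<^sup>2 / 4 * M\<^sup>2 * exp (- (4 / d))"
      using MK \<delta> by (intro mult_strict_right_mono mult_strict_left_mono) auto
    also have "\<dots> \<le> \<delta>\<^sup>2 / 4 * M\<^sup>2 * exp (M * \<delta> - 2 * (e * M + 2 * (1 / d)))"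
    proof -
      have "2 * (e * M) \<le> M * \<delta>" using mult_right_mono[OF e(2), of M] M \<delta> mult_pos_pos[OF M \<delta>] by simp
      then show ?thesis by (intro mult_left_mono) auto
    qed
    finally have "K * v q < \<delta>\<^sup>2 / 4 * M\<^sup>2 * exp (M * \<delta> - 2 * (e * M + 2 * (1 / d))) * v q"
      using pos[of q] by (intro mult_strict_right_mono) (auto simp: v_def)
    then show ?thesis using that by linarith
  qed
  \<comment> \<open>This end point has height \<open>0\<close>, and its path to \<open>X\<close>
    stays in the right half-plane. The path for \<open>b\<close> may reach negative real parts, but
    its height \<open>h \<ge> d\<close> keeps it off the slit.\<close>
  define a where "a = zm (Complex 1 (s * 0))"
  define b where "b = zm (Complex x (s * h))"
  have "a + b = z0 * exp (\<i> * of_real \<theta>) * (1 + exp (of_real \<kappa> * Ln (Complex x (s * h))))"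
    by (simp add: a_def b_def zm_def algebra_simps flip: one_complex.code)
  then have m: "zm (Complex X (s * Y)) = (a + b) / 2"
    unfolding mid[OF s] by (simp add: zm_def)
  have "K * v a < v ((a + b) / 2)"
    unfolding m[symmetric] unfolding a_def
    by (intro big compare right_in_D)
      (use XY d \<delta> in \<open>auto simp: closed_segment_eq_real_ivl split: if_splits\<close>)
  moreover have "K * v b < v ((a + b) / 2)"
    unfolding m[symmetric] unfolding b_def
    by (intro big compare upper_in_D)
      (use XY d \<delta> s in \<open>auto simp: closed_segment_eq_real_ivl abs_mult split: if_splits\<close>)
  ultimately have "K * max (v a) (v b) < v ((a + b) / 2)" by (simp add: max_def)
  then show ?thesis unfolding v_def by blast
qed

subsection \<open>Developing maps and linear equations\<close>

text \<open>Write \<open>f\<close> as a quotient of entire functions \<open>g\<close> and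
  \<open>F\<close> without common zeros. Since \<open>f\<close> is a local homeomorphism, their
  Wronskian has no zeros, and a common factor normalises it to one. Differentiating it then shows
  that both functions have the same potential.\<close>

lemma developing_map_linear_ode:
  assumes "developing_map f u"
  obtains w1 w2 P :: "complex \<Rightarrow> complex"
    where "w1 holomorphic_on UNIV" "w2 holomorphic_on UNIV" "P holomorphic_on UNIV"
      "\<And>z. deriv (deriv w1) z = - P z * w1 z" "\<And>z. deriv (deriv w2) z = - P z * w2 z"
      "\<And>z. deriv w1 z * w2 z - w1 z * deriv w2 z = 1"
      "\<And>z. sphere_map f z = (if w2 z = 0 then Infinity else Finite (w1 z / w2 z))"
      "\<And>z. u z = ln (2 / ((norm (w1 z))\<^sup>2 + (norm (w2 z))\<^sup>2))"
proof -
  have nice: "f nicely_meromorphic_on UNIV"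
    and simple: "\<And>z. is_pole f z \<Longrightarrow> zorder f z = -1"
    and deriv_f: "\<And>z. \<not> is_pole f z \<Longrightarrow> deriv f z \<noteq> 0"
    and u: "\<And>z. \<not> is_pole f z \<Longrightarrow> u z = ln (2 * norm (deriv f z) / (1 + (norm (f z))\<^sup>2))"
    and u_pole: "\<And>z. is_pole f z \<Longrightarrow>
      (\<lambda>w. ln (2 * norm (deriv f w) / (1 + (norm (f w))\<^sup>2))) \<midarrow>z\<rightarrow> u z"
    using assms by (auto simp: developing_map_def meromorphic_local_homeo_def)
  obtain h f1 F where hol: "h holomorphic_on UNIV" "f1 holomorphic_on UNIV" "F holomorphic_on UNIV"
    and f1: "\<And>z. f1 z = 0 \<longleftrightarrow> \<not> is_pole f z \<and> f z = 0"
    and F: "\<And>z. F z = 0 \<longleftrightarrow> is_pole f z"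
    and zF: "\<And>z. is_pole f z \<Longrightarrow> zorder F z = - zorder f z"
    and h: "\<And>z. h z \<noteq> 0" and feq: "\<And>z. f z = h z * f1 z / F z"
    using weierstrass_factorization_meromorphic_UNIV[OF nice] by metis
  define g where "g z = h z * f1 z" for z
  have g: "g holomorphic_on UNIV" unfolding g_def by (intro holomorphic_intros hol)
  \<comment> \<open>Valid at poles too: division by zero gives \<open>0\<close>, the value stored
    there.\<close>
  have f_gF: "f = (\<lambda>z. g z / F z)" using feq by (auto simp: g_def)
  have not_pole: "eventually (\<lambda>w. \<not> is_pole f w) (at z)" for z
    using nice by (intro eventually_not_pole meromorphic_on_isolated_singularity)
      (auto simp: nicely_meromorphic_on_def intro: meromorphic_on_subset)
  have DF: "(F has_field_derivative deriv F z) (at z)" and Dg: "(g has_field_derivative deriv g z) (at z)" for z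
    using hol g by (auto intro!: holomorphic_derivI)
  define \<Omega> where "\<Omega> z = deriv g z * F z - g z * deriv F z" for z
  have df: "deriv f z = \<Omega> z / (F z)\<^sup>2" if "F z \<noteq> 0" for z
    unfolding f_gF \<Omega>_def power2_eq_square
    by (rule DERIV_imp_deriv, rule DERIV_divide[OF Dg DF that])
  \<comment> \<open>Off the poles this is \<open>deriv f z \<noteq> 0\<close>; at a pole the order
    \<open>-1\<close> makes the zero of \<open>F\<close> simple, and \<open>g\<close> does not
    vanish.\<close>
  have \<Omega>: "\<Omega> z \<noteq> 0" for z
  proof (cases "is_pole f z")
    case False
    then show ?thesis using df[of z] deriv_f[of z] F[of z] by auto
  next
    case True
    have "deriv F z \<noteq> 0"
    proof
      assume 0: "deriv F z = 0"
      obtain w where "F w \<noteq> 0" using not_pole[of z] F eventually_happens by fastforce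
      have "(deriv ^^ k) F z = 0" if "k < 2" for k
        using that True F 0 by (auto simp: less_2_cases_iff)
      then have "zorder F z \<ge> int 2"
        using hol(3) \<open>F w \<noteq> 0\<close> by (intro zorder_geI[where A = UNIV and z = w])
          (auto simp: analytic_on_holomorphic)
      then show False using zF[OF True] simple[OF True] by simp
    qed
    moreover have "g z \<noteq> 0" "F z = 0" using True f1[of z] h[of z] F[of z] by (auto simp: g_def)
    ultimately show ?thesis by (simp add: \<Omega>_def)
  qed
  have "\<Omega> holomorphic_on UNIV"
    unfolding \<Omega>_def by (intro holomorphic_intros g hol) auto
  then obtain l where l: "l holomorphic_on UNIV" "\<And>z. \<Omega> z = exp (l z)"
    using contractible_imp_holomorphic_log[of \<Omega> UNIV] \<Omega> by auto
  \<comment> \<open>A square root of \<open>1 / \<Omega>\<close>; multiplying \<open>g\<close> and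
    \<open>F\<close> by \<open>E\<close> multiplies their Wronskian by its square.\<close>
  define E where "E z = exp (- l z / 2)" for z
  have E: "E holomorphic_on UNIV" unfolding E_def by (intro holomorphic_intros l) auto
  have E2: "\<Omega> z * (E z)\<^sup>2 = 1" "E z \<noteq> 0" for z
  proof -
    have "(E z)\<^sup>2 = exp (- l z)"
      unfolding E_def power2_eq_square by (simp flip: exp_add)
    then show "\<Omega> z * (E z)\<^sup>2 = 1" by (simp add: l exp_minus)
    show "E z \<noteq> 0" by (simp add: E_def)
  qed
  define w1 where "w1 z = g z * E z" for z
  define w2 where "w2 z = F z * E z" for z
  have w: "w1 holomorphic_on UNIV" "w2 holomorphic_on UNIV"
    unfolding w1_def w2_def by (intro holomorphic_intros g hol E)+
  have DE: "(E has_field_derivative deriv E z) (at z)" for z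
    using E by (auto intro!: holomorphic_derivI)
  have dw1: "deriv w1 z = deriv g z * E z + deriv E z * g z"
    and dw2: "deriv w2 z = deriv F z * E z + deriv E z * F z" for z
    unfolding w1_def w2_def by (auto intro!: DERIV_imp_deriv DERIV_mult Dg DF DE)
  have wronskian: "deriv w1 z * w2 z - w1 z * deriv w2 z = 1" for z
  proof -
    have "deriv w1 z * w2 z - w1 z * deriv w2 z = \<Omega> z * (E z)\<^sup>2"
      unfolding dw1 dw2 by (simp add: w1_def w2_def \<Omega>_def power2_eq_square algebra_simps)
    then show ?thesis by (simp add: E2)
  qed
  have D1: "(w1 has_field_derivative deriv w1 z) (at z)" "(w2 has_field_derivative deriv w2 z) (at z)"
     "(deriv w1 has_field_derivative deriv (deriv w1) z) (at z)"
     "(deriv w2 has_field_derivative deriv (deriv w2) z) (at z)" for z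
    using w by (auto intro!: holomorphic_derivI[of _ UNIV] holomorphic_deriv)
  have w''_eq: "deriv (deriv w1) z * w2 z = w1 z * deriv (deriv w2) z" for z
  proof -
    have "((\<lambda>z. deriv w1 z * w2 z - w1 z * deriv w2 z) has_field_derivative
        deriv (deriv w1) z * w2 z - w1 z * deriv (deriv w2) z) (at z)"
      by (rule derivative_eq_intros D1 refl)+ (simp add: algebra_simps)
    moreover have "((\<lambda>z. deriv w1 z * w2 z - w1 z * deriv w2 z) has_field_derivative 0) (at z)"
      unfolding wronskian by simp
    ultimately show ?thesis using DERIV_unique by fastforce
  qed
  \<comment> \<open>Solving for the potential by means of the Wronskian avoids division, so
    \<open>P\<close> is entire even where \<open>w1\<close> or \<open>w2\<close> vanishes.\<close>
  define P where "P z = deriv (deriv w1) z * deriv w2 z - deriv w1 z * deriv (deriv w2) z" for z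
  have P: "P holomorphic_on UNIV"
    unfolding P_def by (intro holomorphic_intros w) auto
  have P1: "deriv (deriv w1) z = - P z * w1 z" for z
  proof -
    have "- P z * w1 z = deriv w1 z * (w1 z * deriv (deriv w2) z) - deriv (deriv w1) z * (w1 z * deriv w2 z)"
      by (simp add: P_def algebra_simps)
    also have "\<dots> = deriv (deriv w1) z * (deriv w1 z * w2 z - w1 z * deriv w2 z)"
      unfolding w''_eq[symmetric] by (simp add: algebra_simps)
    finally show ?thesis by (simp add: wronskian)
  qed
  have P2: "deriv (deriv w2) z = - P z * w2 z" for z
  proof -
    have "- P z * w2 z = deriv (deriv w2) z * (deriv w1 z * w2 z) - (deriv (deriv w1) z * w2 z) * deriv w2 z"
      by (simp add: P_def algebra_simps)
    also have "\<dots> = deriv (deriv w2) z * (deriv w1 z * w2 z - w1 z * deriv w2 z)"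
      unfolding w''_eq by (simp add: algebra_simps)
    finally show ?thesis by (simp add: wronskian)
  qed
  have w2_pole: "w2 z = 0 \<longleftrightarrow> is_pole f z" for z using F E2 by (simp add: w2_def)
  have f_w: "f z = w1 z / w2 z" for z using E2 by (simp add: f_gF w1_def w2_def)
  let ?v = "\<lambda>z. (norm (w1 z))\<^sup>2 + (norm (w2 z))\<^sup>2"
  have v: "?v z > 0" for z
    using wronskian[of z] by (auto simp: sum_power2_gt_zero_iff)
  have formula: "2 * norm (deriv f z) / (1 + (norm (f z))\<^sup>2) = 2 / ?v z" if "w2 z \<noteq> 0" for z
  proof -
    have "deriv f z = (deriv w1 z * w2 z - w1 z * deriv w2 z) / (w2 z * w2 z)"
      unfolding ext[of f, OF f_w] by (rule DERIV_imp_deriv, rule DERIV_divide[OF D1(1,2) that])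
    then have "norm (deriv f z) = 1 / (norm (w2 z))\<^sup>2"
      by (simp add: wronskian norm_divide norm_mult power2_eq_square)
    moreover have "1 + (norm (f z))\<^sup>2 = ?v z / (norm (w2 z))\<^sup>2"
      using that by (simp add: f_w norm_divide power_divide field_simps)
    ultimately show ?thesis using that by simp
  qed
  have u_w: "u z = ln (2 / ?v z)" for z
  proof (cases "is_pole f z")
    case False
    then have nz: "w2 z \<noteq> 0" by (simp add: w2_pole)
    have "u z = ln (2 * norm (deriv f z) / (1 + (norm (f z))\<^sup>2))"
      by (rule u[OF False])
    also have "2 * norm (deriv f z) / (1 + (norm (f z))\<^sup>2) = 2 / ?v z"
      by (rule formula[OF nz])
    finally show ?thesis .
  next
    case True
    \<comment> \<open>At a pole \<open>u\<close> is given by a limit; the new formula is continuous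
      and agrees with the old one at nearby points.\<close>
    have "w1 \<midarrow>z\<rightarrow> w1 z" "w2 \<midarrow>z\<rightarrow> w2 z"
      using DERIV_isCont[OF D1(1)] DERIV_isCont[OF D1(2)] by (simp_all add: isCont_def)
    then have "(\<lambda>z. ln (2 / ?v z)) \<midarrow>z\<rightarrow> ln (2 / ?v z)"
      by (intro tendsto_intros) (use v[of z] in \<open>auto simp del: zero_less_power2\<close>)
    moreover have "eventually (\<lambda>w. ln (2 / ?v w) = ln (2 * norm (deriv f w) / (1 + (norm (f w))\<^sup>2))) (at z)"
      using not_pole[of z] by eventually_elim (subst formula, auto simp: w2_pole)
    ultimately have "(\<lambda>w. ln (2 * norm (deriv f w) / (1 + (norm (f w))\<^sup>2))) \<midarrow>z\<rightarrow> ln (2 / ?v z)"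
      by (rule Lim_transform_eventually)
    with u_pole[OF True] show ?thesis by (rule LIM_unique)
  qed
  have "sphere_map f z = (if w2 z = 0 then Infinity else Finite (w1 z / w2 z))" for z
    by (simp add: sphere_map_def w2_pole f_w)
  then show thesis by (rule that[OF w P P1 P2 wronskian _ u_w])
qed

section \<open>Equations with constant potential\<close>

lemma entire_constant_if_deriv_zero:
  fixes g :: "complex \<Rightarrow> complex"
  assumes "\<And>z. (g has_field_derivative 0) (at z)"
  shows "g z = g 0"
  using has_field_derivative_zero_constant[of UNIV g] assms by force

lemma second_derivative_zero_imp_affine:
  fixes w :: "complex \<Rightarrow> complex"
  assumes w: "w holomorphic_on UNIV" and ode: "\<And>z. deriv (deriv w) z = 0"
  shows "w z = deriv w 0 * z + w 0"
proof -
  have D: "(w has_field_derivative deriv w z) (at z)" "(deriv w has_field_derivative 0) (at z)" for z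
    using w holomorphic_derivI[OF holomorphic_deriv[OF w]] ode by (auto intro!: holomorphic_derivI)
  have const: "deriv w z = deriv w 0" for z by (rule entire_constant_if_deriv_zero[OF D(2)])
  have "((\<lambda>z. w z - deriv w 0 * z) has_field_derivative 0) (at z)" for z
    by (rule derivative_eq_intros D refl)+ (simp add: const[of z])
  from entire_constant_if_deriv_zero[OF this, of z] show ?thesis by (simp add: algebra_simps)
qed

text \<open>The operator factors, so \<open>(w' + \<mu> w) * exp (- (\<mu> * z))\<close> and
  \<open>(w' - \<mu> w) * exp (\<mu> * z)\<close> are constant; \<open>w\<close> is found from these
  two linear relations.\<close>

lemma second_derivative_imp_exponential:
  fixes w :: "complex \<Rightarrow> complex"
  assumes w: "w holomorphic_on UNIV" and ode: "\<And>z. deriv (deriv w) z = \<mu>\<^sup>2 * w z" and \<mu>: "\<mu> \<noteq> 0"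
  obtains A B where "\<And>z. w z = A * exp (\<mu> * z) + B * exp (- (\<mu> * z))"
proof -
  have D: "(w has_field_derivative deriv w z) (at z)" "(deriv w has_field_derivative \<mu>\<^sup>2 * w z) (at z)" for z
    using w holomorphic_derivI[OF holomorphic_deriv[OF w]] ode by (auto intro!: holomorphic_derivI)
  define p where "p = deriv w 0 + \<mu> * w 0"
  define q where "q = deriv w 0 - \<mu> * w 0"
  have "((\<lambda>z. (deriv w z + \<mu> * w z) * exp (- (\<mu> * z))) has_field_derivative 0) (at z)" for z
    by (rule derivative_eq_intros D refl)+ (simp add: algebra_simps power2_eq_square)
  then have "(deriv w z + \<mu> * w z) * exp (- (\<mu> * z)) = p" for z
    using entire_constant_if_deriv_zero[of "\<lambda>z. (deriv w z + \<mu> * w z) * exp (- (\<mu> * z))" z]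
    by (simp add: p_def)
  then have 1: "deriv w z + \<mu> * w z = p * exp (\<mu> * z)" for z
    by (metis exp_minus_inverse mult.assoc mult.commute mult.right_neutral)
  have "((\<lambda>z. (deriv w z - \<mu> * w z) * exp (\<mu> * z)) has_field_derivative 0) (at z)" for z
    by (rule derivative_eq_intros D refl)+ (simp add: algebra_simps power2_eq_square)
  then have "(deriv w z - \<mu> * w z) * exp (\<mu> * z) = q" for z
    using entire_constant_if_deriv_zero[of "\<lambda>z. (deriv w z - \<mu> * w z) * exp (\<mu> * z)" z]
    by (simp add: q_def)
  then have 2: "deriv w z - \<mu> * w z = q * exp (- (\<mu> * z))" for z
    by (metis exp_minus_inverse mult.assoc mult.right_neutral)
  have "w z = p / (2 * \<mu>) * exp (\<mu> * z) + (- q / (2 * \<mu>)) * exp (- (\<mu> * z))" for z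
  proof -
    have "2 * \<mu> * w z = p * exp (\<mu> * z) - q * exp (- (\<mu> * z))"
      unfolding 1[symmetric] 2[symmetric] by simp
    then show ?thesis using \<mu> by (simp add: field_simps)
  qed
  then show thesis by (rule that)
qed

text \<open>For \<open>c = 0\<close> numerator and denominator are affine. Otherwise both combine
  \<open>exp (\<mu> * z)\<close> and \<open>exp (- (\<mu> * z))\<close>, and expanding the quotient
  by \<open>exp (\<mu> * z)\<close> leaves a Moebius map of \<open>exp (2 * \<mu> * z)\<close>. The
  Wronskian makes the determinant nonzero.\<close>

lemma constant_potential:
  fixes w1 w2 :: "complex \<Rightarrow> complex"
  assumes w1: "w1 holomorphic_on UNIV" and w2: "w2 holomorphic_on UNIV"
    and ode1: "\<And>z. deriv (deriv w1) z = - c * w1 z" and ode2: "\<And>z. deriv (deriv w2) z = - c * w2 z"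
    and wronskian: "\<And>z. deriv w1 z * w2 z - w1 z * deriv w2 z = 1"
    and f: "\<And>z. sphere_map f z = (if w2 z = 0 then Infinity else Finite (w1 z / w2 z))"
  shows "is_linear_fractional f \<or> is_linear_fractional_of_exp f"
proof (cases "c = 0")
  case True
  have affine: "w1 z = deriv w1 0 * z + w1 0" "w2 z = deriv w2 0 * z + w2 0" for z
    using second_derivative_zero_imp_affine w1 w2 ode1 ode2 True by auto
  define L where "L = sphere_moebius (deriv w1 0) (w1 0) (deriv w2 0) (w2 0)"
  have "linear_fractional L"
    unfolding linear_fractional_def L_def using wronskian[of 0] by (metis zero_neq_one)
  moreover have "sphere_map f z = L (Finite z)" for z
    unfolding f L_def using affine[of z] by (simp add: moebius_def)
  ultimately show ?thesis unfolding is_linear_fractional_def by blast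
next
  case False
  define \<mu> where "\<mu> = csqrt (- c)"
  have \<mu>: "\<mu>\<^sup>2 = - c" "\<mu> \<noteq> 0" using False by (auto simp: \<mu>_def)
  obtain A B where AB: "\<And>z. w1 z = A * exp (\<mu> * z) + B * exp (- (\<mu> * z))"
    using second_derivative_imp_exponential[OF w1 _ \<mu>(2)] ode1 \<mu>(1) by metis
  obtain C D where CD: "\<And>z. w2 z = C * exp (\<mu> * z) + D * exp (- (\<mu> * z))"
    using second_derivative_imp_exponential[OF w2 _ \<mu>(2)] ode2 \<mu>(1) by metis
  have "((\<lambda>z. a * exp (\<mu> * z) + b * exp (- (\<mu> * z))) has_field_derivative \<mu> * (a - b)) (at 0)" for a b
    by (auto intro!: derivative_eq_intros simp: algebra_simps)
  then have "deriv w1 0 = \<mu> * (A - B)" "deriv w2 0 = \<mu> * (C - D)"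
    unfolding ext[of w1, OF AB] ext[of w2, OF CD] by (simp_all add: DERIV_imp_deriv)
  then have "\<mu> * (A - B) * (C + D) - (A + B) * (\<mu> * (C - D)) = 1"
    using wronskian[of 0] by (simp only: AB CD) simp
  then have "2 * \<mu> * (A * D - B * C) = 1" by (simp add: algebra_simps)
  then have det: "A * D - B * C \<noteq> 0" by auto
  define L where "L = sphere_moebius A B C D"
  have "linear_fractional L" unfolding linear_fractional_def L_def using det by blast
  moreover have "sphere_map f z = L (Finite (exp (2 * \<mu> * z + 0)))" for z
  proof -
    have e: "exp (2 * \<mu> * z) = exp (\<mu> * z) * exp (\<mu> * z)"
      by (simp add: mult.assoc flip: exp_add)
    have num: "A * exp (2 * \<mu> * z) + B = w1 z * exp (\<mu> * z)"
      and den: "C * exp (2 * \<mu> * z) + D = w2 z * exp (\<mu> * z)"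
      unfolding AB CD e by (simp_all add: exp_minus field_simps)
    show ?thesis unfolding f L_def by (simp add: moebius_def num den)
  qed
  moreover have "2 * \<mu> \<noteq> 0" using \<mu> by simp
  ultimately show ?thesis unfolding is_linear_fractional_of_exp_def by blast
qed

text \<open>Rules out the linear-fractional alternative for transcendental \<open>f\<close>.\<close>

lemma linear_fractional_imp_rational:
  assumes "is_linear_fractional f"
  shows "rational_function f"
proof -
  obtain a b c d where det: "a * d - b * c \<noteq> 0" and f: "\<And>z. sphere_map f z = sphere_moebius a b c d (Finite z)"
    using assms unfolding is_linear_fractional_def linear_fractional_def by blast
  have "[:d, c:] \<noteq> 0" using det by auto
  moreover have "f z = poly [:b, a:] z / poly [:d, c:] z" if "poly [:d, c:] z \<noteq> 0" for z
    using that f[of z] by (auto simp: sphere_map_def moebius_def algebra_simps split: if_splits)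
  ultimately show ?thesis unfolding rational_function_def by blast
qed

theorem theorem1p2:
  fixes u :: "complex \<Rightarrow> real" and f :: "complex \<Rightarrow> complex"
  assumes "liouville_solution u"
    and "developing_map f u"
  shows "(quasiconcave u \<longrightarrow> is_linear_fractional f \<or> is_linear_fractional_of_exp f)
    \<and> (transcendental_meromorphic f \<and> \<not> is_linear_fractional_of_exp f \<longrightarrow>
        (\<forall>M>0. \<exists>a\<^sub>1 a\<^sub>2. u ((a\<^sub>1 + a\<^sub>2) / 2) < min (u a\<^sub>1) (u a\<^sub>2) - M))"
proof -
  obtain w1 w2 P :: "complex \<Rightarrow> complex"
    where w: "w1 holomorphic_on UNIV" "w2 holomorphic_on UNIV" "P holomorphic_on UNIV"
      and ode: "\<And>z. deriv (deriv w1) z = - P z * w1 z" "\<And>z. deriv (deriv w2) z = - P z * w2 z"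
      and wronskian: "\<And>z. deriv w1 z * w2 z - w1 z * deriv w2 z = 1"
      and f: "\<And>z. sphere_map f z = (if w2 z = 0 then Infinity else Finite (w1 z / w2 z))"
      and u: "\<And>z. u z = ln (2 / ((norm (w1 z))\<^sup>2 + (norm (w2 z))\<^sup>2))"
    using developing_map_linear_ode[OF assms(2)] by blast
  define v where "v z = (norm (w1 z))\<^sup>2 + (norm (w2 z))\<^sup>2" for z
  have v: "v z > 0" for z
    using wronskian[of z] by (auto simp: v_def sum_power2_gt_zero_iff)
  show ?thesis
  proof (cases "P constant_on UNIV")
    case True
    then obtain c where "\<And>z. P z = c" by (auto simp: constant_on_def)
    then have "is_linear_fractional f \<or> is_linear_fractional_of_exp f"
      using constant_potential[OF w(1,2) _ _ wronskian f, of c] ode by simp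
    then show ?thesis
      using linear_fractional_imp_rational by (auto simp: transcendental_meromorphic_def)
  next
    case False
    \<comment> \<open>As \<open>u = ln (2 / v)\<close>, a factor \<open>exp M\<close> between values
      of \<open>v\<close> is a difference \<open>M\<close> between values of
      \<open>u\<close>.\<close>
    have violation: "\<exists>a b. u ((a + b) / 2) < min (u a) (u b) - M" for M
    proof -
      obtain a b where "exp M * max (v a) (v b) < v ((a + b) / 2)"
        using oscillation_midpoint_violation[OF w ode False v[unfolded v_def] exp_gt_zero[of M]]
        unfolding v_def by blast
      moreover have "exp M * v a \<le> exp M * max (v a) (v b)" "exp M * v b \<le> exp M * max (v a) (v b)"
        by simp_all
      ultimately have less: "exp M * v a < v ((a + b) / 2)" "exp M * v b < v ((a + b) / 2)"
        by linarith+
      have "u ((a + b) / 2) < u c - M" if "exp M * v c < v ((a + b) / 2)" for c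
      proof -
        have "ln (exp M * v c) < ln (v ((a + b) / 2))"
          using that v by (subst ln_less_cancel_iff) auto
        then show ?thesis
          using v[of c] v[of "(a + b) / 2"] by (simp add: u ln_mult ln_div flip: v_def)
      qed
      from this[OF less(1)] this[OF less(2)] show ?thesis
        by (intro exI[of _ a] exI[of _ b]) (simp add: min_def)
    qed
    have "\<not> quasiconcave u"
    proof
      assume q: "quasiconcave u"
      obtain a b where ab: "u ((a + b) / 2) < min (u a) (u b) - 1" using violation by blast
      have "(a + b) / 2 \<in> closed_segment a b"
        using midpoint_in_closed_segment[of a b] by (simp add: midpoint_def scaleR_conv_of_real field_simps)
      then have "min (u a) (u b) \<le> u ((a + b) / 2)"
        using q unfolding quasiconcave_def by blast
      with ab show False by simp
    qed
    then show ?thesis using violation by blast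
  qed
qed

end
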